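(* Let $N$ be the once-punctured hyperbolic torus bundle with $$\pi_1(N)=\left\langle\alpha,\beta,\tau\;\middle|\;\tau\alpha\tau^{-1}=(\beta\alpha\beta)^{-1},\ \tau\beta\tau^{-1}=\beta\alpha(\beta\alpha\beta)^{-3}\right\rangle,$$ let $\lambda=[\alpha,\beta]$, and let $\mathsf{X}_0,\mathsf{X}_1$ be the two hyperbolic curves in $\mathsf{X}(N)$. Put $l=I_\lambda$, $t=I_\tau$, $u=I_{\alpha\tau}$, $v=I_{\beta\tau}$, $w=I_{\alpha\beta\tau}$, $x=I_\alpha$, $y=I_\beta$, $z=I_{\alpha\beta}$. For each $\epsilon\in\{0,1\}$ the set $$\mathcal{B}_{\mathbb{Z}}=\{1,y,y^2,y^3,t,u,v,w,x,z,ty,uy,xy,xy^2,tx,ux,vy\}$$ generates $T(\mathsf{X}_\epsilon)$ as a $\mathbb{Z}[l]$-module.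
   Context: $\mathsf{X}(N)$ is the affine algebraic set of characters $\chi_\rho=\mathrm{Tr}\circ\rho$ of representations $\rho\colon\pi_1(N)\to\mathrm{SL}_2(\mathbb{C})$. A hyperbolic curve is an irreducible algebraic component of $\mathsf{X}(N)$ containing the character of a discrete faithful representation; for this $N$ there are exactly two, labelled $\mathsf{X}_0$ and $\mathsf{X}_1$. For $\gamma\in\pi_1(N)$, $I_\gamma\in\mathbb{C}[\mathsf{X}_\epsilon]$ is the regular function $I_\gamma(\chi)=\chi(\gamma)$. $T(\mathsf{X}_\epsilon)$ is the subring (with 1) of $\mathbb{C}[\mathsf{X}_\epsilon]$ generated by all $I_\gamma$, $\gamma\in\pi_1(N)$. *)

theory Defs
  imports "HOL-Analysis.Analysis" "HOL-Algebra.Generated_Rings"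
begin

section \<open>Groups given by generators and relations\<close>

text \<open>A word is a list of signed letters; the pair \<open>(g, True)\<close> stands for the generator \<open>g\<close> and
  \<open>(g, False)\<close> for its formal inverse.  A relation \<open>p = q\<close> is recorded as the pair \<open>(p, q)\<close> of words.\<close>

type_synonym 'g word = "('g \<times> bool) list"

definition word_inv :: "'g word \<Rightarrow> 'g word" where
  "word_inv w = rev (map (\<lambda>(g, b). (g, \<not> b)) w)"

inductive pres_step :: "('g word \<times> 'g word) set \<Rightarrow> 'g word \<Rightarrow> 'g word \<Rightarrow> bool"
  for E where
  cancel: "pres_step E (u @ [(g, b), (g, \<not> b)] @ v) (u @ v)"
| relation: "(p, q) \<in> E \<Longrightarrow> pres_step E (u @ p @ v) (u @ q @ v)"

definition pres_class :: "('g word \<times> 'g word) set \<Rightarrow> 'g word \<Rightarrow> 'g word set" where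
  "pres_class E w = {w'. equivclp (pres_step E) w w'}"

definition presented_group :: "('g word \<times> 'g word) set \<Rightarrow> 'g word set monoid" where
  "presented_group E =
     \<lparr>carrier = range (pres_class E),
      mult = (\<lambda>A B. \<Union>p\<in>A. \<Union>q\<in>B. pres_class E (p @ q)),
      one = pres_class E []\<rparr>"

definition pres_gen :: "('g word \<times> 'g word) set \<Rightarrow> 'g \<Rightarrow> 'g word set" where
  "pres_gen E g = pres_class E [(g, True)]"

lemma pres_class_eq_iff: "pres_class E p = pres_class E q \<longleftrightarrow> equivclp (pres_step E) p q"
  unfolding pres_class_def
  by (auto intro: equivclp_trans equivclp_sym)

lemma pres_step_context:
  assumes "pres_step E p q"
  shows "pres_step E (u @ p @ v) (u @ q @ v)"
  using assms
proof cases
  case (cancel a g b c)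
  then show ?thesis using pres_step.cancel[of E "u @ a" g b "c @ v"] by simp
next
  case (relation r s a c)
  then show ?thesis using pres_step.relation[of r s E "u @ a" "c @ v"] by simp
qed

lemma equivclp_pres_step_context:
  assumes "equivclp (pres_step E) p q"
  shows "equivclp (pres_step E) (u @ p @ v) (u @ q @ v)"
  using assms
proof (induction rule: equivclp_induct)
  case base
  then show ?case by simp
next
  case (step y z)
  then have "equivclp (pres_step E) (u @ y @ v) (u @ z @ v)"
    by (meson equivclp_sym pres_step_context r_into_equivclp)
  then show ?case using step.IH equivclp_trans by metis
qed

lemma presented_group_mult:
  "pres_class E p \<otimes>\<^bsub>presented_group E\<^esub> pres_class E q = pres_class E (p @ q)"
proof -
  have "pres_class E (p' @ q') = pres_class E (p @ q)"
    if "p' \<in> pres_class E p" "q' \<in> pres_class E q" for p' q'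
  proof -
    have p': "equivclp (pres_step E) p p'" and q': "equivclp (pres_step E) q q'"
      using that by (auto simp: pres_class_def)
    have "equivclp (pres_step E) (p @ q) (p' @ q)"
      using equivclp_pres_step_context[OF p', of "[]" q] by simp
    moreover have "equivclp (pres_step E) (p' @ q) (p' @ q')"
      using equivclp_pres_step_context[OF q', of p' "[]"] by simp
    ultimately show ?thesis
      by (metis pres_class_eq_iff)
  qed
  moreover have "p \<in> pres_class E p" "q \<in> pres_class E q"
    by (simp_all add: pres_class_def)
  ultimately show ?thesis
    unfolding presented_group_def monoid.simps by blast
qed

lemma pres_class_word_inv: "pres_class E (word_inv w @ w) = pres_class E []"
proof (induction w)
  case Nil
  then show ?case by (simp add: word_inv_def)
next
  case (Cons x w)
  obtain g b where x: "x = (g, b)" by fastforce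
  have "pres_step E (word_inv w @ [(g, \<not> b), (g, \<not> \<not> b)] @ w) (word_inv w @ w)"
    by (rule pres_step.cancel)
  then have "pres_class E (word_inv (x # w) @ x # w) = pres_class E (word_inv w @ w)"
    unfolding pres_class_eq_iff by (simp add: x word_inv_def r_into_equivclp)
  then show ?case using Cons.IH by simp
qed

lemma group_presented_group: "group (presented_group E)"
proof (rule groupI)
  have car: "carrier (presented_group E) = range (pres_class E)"
    and one: "\<one>\<^bsub>presented_group E\<^esub> = pres_class E []"
    by (simp_all add: presented_group_def)
  show "\<one>\<^bsub>presented_group E\<^esub> \<in> carrier (presented_group E)"
    by (simp add: car one)
  fix x assume "x \<in> carrier (presented_group E)"
  then obtain p where x: "x = pres_class E p" by (auto simp: car)
  show "\<one>\<^bsub>presented_group E\<^esub> \<otimes>\<^bsub>presented_group E\<^esub> x = x"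
    by (simp add: x one presented_group_mult)
  show "\<exists>y\<in>carrier (presented_group E). y \<otimes>\<^bsub>presented_group E\<^esub> x = \<one>\<^bsub>presented_group E\<^esub>"
    by (rule bexI[of _ "pres_class E (word_inv p)"])
      (simp_all add: x one car presented_group_mult pres_class_word_inv)
  fix y assume "y \<in> carrier (presented_group E)"
  then obtain q where y: "y = pres_class E q" by (auto simp: car)
  show "x \<otimes>\<^bsub>presented_group E\<^esub> y \<in> carrier (presented_group E)"
    by (simp add: x y car presented_group_mult)
  fix z assume "z \<in> carrier (presented_group E)"
  then obtain r where z: "z = pres_class E r" by (auto simp: car)
  show "x \<otimes>\<^bsub>presented_group E\<^esub> y \<otimes>\<^bsub>presented_group E\<^esub> z
      = x \<otimes>\<^bsub>presented_group E\<^esub> (y \<otimes>\<^bsub>presented_group E\<^esub> z)"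
    by (simp add: x y z presented_group_mult)
qed


section \<open>The fundamental group of \<open>N\<close>\<close>

datatype letter = Alpha | Beta | Tau

definition N_relations :: "(letter word \<times> letter word) set" where
  "N_relations =
    (let a = [(Alpha, True)]; b = [(Beta, True)]; t = [(Tau, True)]
     in {(t @ a @ word_inv t, word_inv (b @ a @ b)),
         (t @ b @ word_inv t, b @ a @ concat (replicate 3 (word_inv (b @ a @ b))))})"

definition pi1N :: "letter word set monoid" where
  "pi1N = presented_group N_relations"

definition \<alpha> :: "letter word set" where "\<alpha> = pres_gen N_relations Alpha"
definition \<beta> :: "letter word set" where "\<beta> = pres_gen N_relations Beta"
definition \<tau> :: "letter word set" where "\<tau> = pres_gen N_relations Tau"


section \<open>Characters of representations into \<open>SL\<^sub>2(\<complex>)\<close>\<close>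

definition SL2C :: "(complex ^ 2 ^ 2) monoid" where
  "SL2C = \<lparr>carrier = {A. det A = 1}, mult = (**), one = mat 1\<rparr>"

text \<open>Characters are functions on the group, so they are normalised to be \<open>undefined\<close> off its carrier.\<close>

definition char_of :: "('a, 'm) monoid_scheme \<Rightarrow> ('a \<Rightarrow> complex ^ 2 ^ 2) \<Rightarrow> 'a \<Rightarrow> complex" where
  "char_of G \<rho> = (\<lambda>\<gamma>\<in>carrier G. trace (\<rho> \<gamma>))"

definition char_variety :: "('a, 'm) monoid_scheme \<Rightarrow> ('a \<Rightarrow> complex) set" where
  "char_variety G = char_of G ` hom G SL2C"

definition discrete_faithful :: "('a, 'm) monoid_scheme \<Rightarrow> ('a \<Rightarrow> complex ^ 2 ^ 2) \<Rightarrow> bool" where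
  "discrete_faithful G \<rho> \<longleftrightarrow>
     \<rho> \<in> hom G SL2C \<and> inj_on \<rho> (carrier G) \<and> discrete (\<rho> ` carrier G)"


section \<open>Regular functions and algebraic subsets\<close>

definition function_ring :: "'s set \<Rightarrow> ('s \<Rightarrow> complex) ring" where
  "function_ring S =
     \<lparr>carrier = S \<rightarrow>\<^sub>E UNIV,
      mult = (\<lambda>f g. \<lambda>s\<in>S. f s * g s),
      one = (\<lambda>s\<in>S. 1),
      ring.zero = (\<lambda>s\<in>S. 0),
      ring.add = (\<lambda>f g. \<lambda>s\<in>S. f s + g s)\<rparr>"

lemma cring_function_ring: "cring (function_ring S)"
proof -
  have "\<exists>g. (\<forall>s. s \<notin> S \<longrightarrow> g s = undefined) \<and> (\<forall>s. s \<in> S \<longrightarrow> f s + g s = 0)"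
    for f :: "'a \<Rightarrow> complex"
    by (rule exI[of _ "\<lambda>s\<in>S. - f s"]) auto
  then show ?thesis
    by (intro cringI abelian_groupI comm_monoidI)
      (auto simp: function_ring_def algebra_simps PiE_def extensional_def restrict_def fun_eq_iff)
qed

text \<open>The evaluation function \<open>I\<^sub>\<gamma>(\<kappa>) = \<kappa>(\<gamma>)\<close> on a set \<open>X\<close> of characters.\<close>

definition eval_fun :: "('a \<Rightarrow> complex) set \<Rightarrow> 'a \<Rightarrow> ('a \<Rightarrow> complex) \<Rightarrow> complex" where
  "eval_fun X \<gamma> = (\<lambda>\<kappa>\<in>X. \<kappa> \<gamma>)"

text \<open>For finitely generated \<open>G\<close>, finitely many of the functions \<open>I\<^sub>\<gamma>\<close> embed \<open>char_variety G\<close> in an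
  affine space, and every other \<open>I\<^sub>\<gamma>\<close> is a polynomial in these coordinates.  The regular functions
  are therefore the polynomials with complex coefficients in all the \<open>I\<^sub>\<gamma>\<close>, and no choice of
  coordinates has to be made.\<close>

definition coordinate_ring ::
    "('a, 'm) monoid_scheme \<Rightarrow> ('a \<Rightarrow> complex) set \<Rightarrow> (('a \<Rightarrow> complex) \<Rightarrow> complex) ring" where
  "coordinate_ring G X = (function_ring X)
     \<lparr>carrier := generate_ring (function_ring X)
        (range (\<lambda>c. \<lambda>\<kappa>\<in>X. c) \<union> eval_fun X ` carrier G)\<rparr>"

definition algebraic_subset :: "('a, 'm) monoid_scheme \<Rightarrow> ('a \<Rightarrow> complex) set \<Rightarrow> bool" where
  "algebraic_subset G Y \<longleftrightarrow>
     (\<exists>F \<subseteq> carrier (coordinate_ring G (char_variety G)).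
        Y = {\<kappa> \<in> char_variety G. \<forall>f\<in>F. f \<kappa> = 0})"

definition irreducible_subset :: "('a, 'm) monoid_scheme \<Rightarrow> ('a \<Rightarrow> complex) set \<Rightarrow> bool" where
  "irreducible_subset G Y \<longleftrightarrow>
     algebraic_subset G Y \<and> Y \<noteq> {} \<and>
     (\<forall>Y1 Y2. algebraic_subset G Y1 \<and> algebraic_subset G Y2 \<and> Y = Y1 \<union> Y2 \<longrightarrow> Y = Y1 \<or> Y = Y2)"

definition irreducible_component :: "('a, 'm) monoid_scheme \<Rightarrow> ('a \<Rightarrow> complex) set \<Rightarrow> bool" where
  "irreducible_component G Y \<longleftrightarrow>
     irreducible_subset G Y \<and> (\<forall>Y'. irreducible_subset G Y' \<and> Y \<subseteq> Y' \<longrightarrow> Y' = Y)"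

definition hyperbolic_curve :: "('a, 'm) monoid_scheme \<Rightarrow> ('a \<Rightarrow> complex) set \<Rightarrow> bool" where
  "hyperbolic_curve G X \<longleftrightarrow>
     irreducible_component G X \<and> (\<exists>\<rho>. discrete_faithful G \<rho> \<and> char_of G \<rho> \<in> X)"


section \<open>The trace ring as a module\<close>

definition trace_ring ::
    "('a, 'm) monoid_scheme \<Rightarrow> ('a \<Rightarrow> complex) set \<Rightarrow> (('a \<Rightarrow> complex) \<Rightarrow> complex) ring" where
  "trace_ring G X = (coordinate_ring G X)
     \<lparr>carrier := generate_ring (coordinate_ring G X) (eval_fun X ` carrier G)\<rparr>"

text \<open>\<open>int_adjoin R l\<close> is the subring \<open>\<int>[l]\<close> of \<open>R\<close>.\<close>

definition int_adjoin :: "('r, 'm) ring_scheme \<Rightarrow> 'r \<Rightarrow> ('r, 'm) ring_scheme" where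
  "int_adjoin R l = R\<lparr>carrier := generate_ring R {l}\<rparr>"

text \<open>\<open>R\<close> acting on itself, and hence also acted on by its subrings, by multiplication.\<close>

definition mult_module :: "'r ring \<Rightarrow> ('r, 'r) module" where
  "mult_module R = ring.extend R \<lparr>smult = (\<otimes>\<^bsub>R\<^esub>)\<rparr>"

definition generates_module ::
    "('k, 'm) ring_scheme \<Rightarrow> ('k, 'v, 'n) module_scheme \<Rightarrow> 'v set \<Rightarrow> bool" where
  "generates_module K M B \<longleftrightarrow>
     B \<subseteq> carrier M \<and> (\<forall>H. submodule H K M \<and> B \<subseteq> H \<longrightarrow> H = carrier M)"

end

theory Submission
  imports Defs
begin

text \<open>On the character variety the two relations of the group give polynomial relations between the
  traces, such as \<open>y z = 2 x\<close> and \<open>x w = y t\<close>.  The value of \<open>y\<close> at a faithful character is neither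
  \<open>0\<close> nor \<open>\<plusminus>2\<close>, because \<open>\<beta>\<^sup>4 \<noteq> 1\<close> and \<open>\<alpha>\<close>, \<open>\<beta>\<close> do not commute; since a hyperbolic curve is
  irreducible, \<open>y\<close> and \<open>y\<^sup>2 - 4\<close> may be cancelled on it.  This yields \<open>(t (y\<^sup>2 - 2))\<^sup>2 = -16\<close>, so
  \<open>t (y\<^sup>2 - 2) = 4 j\<close> for a constant \<open>j = \<plusminus>\<i>\<close>, and then
  \<open>t = j (l + 4 - y\<^sup>2)\<close>, \<open>u = j x\<close>, \<open>v = y t - j y\<close>, \<open>w = j z\<close>.
  The \<open>\<int>[l]\<close>-module \<open>E\<close> spanned by \<open>1, y, y\<^sup>2, y\<^sup>3, x, z, x y, x y\<^sup>2\<close> is a ring, the module \<open>J\<close> spanned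
  by the other nine elements is an \<open>E\<close>-module, and \<open>j J \<subseteq> E\<close>.  Hence \<open>J J \<subseteq> E\<close> and \<open>E + J\<close> is a ring;
  it contains the seven traces that generate the trace ring.\<close>

section \<open>Words and presented groups\<close>

lemma pres_class_context:
  "pres_class E p = pres_class E q \<Longrightarrow> pres_class E (u @ p @ v) = pres_class E (u @ q @ v)"
  by (simp add: pres_class_eq_iff equivclp_pres_step_context)

lemma pres_class_relation: "(p, q) \<in> E \<Longrightarrow> pres_class E p = pres_class E q"
  using pres_step.relation[of p q E "[]" "[]"] by (simp add: pres_class_eq_iff r_into_equivclp)

lemma word_inv_word_inv [simp]: "word_inv (word_inv w) = w"
  by (induction w) (auto simp: word_inv_def rev_map)

lemma pres_class_cancel:
  "pres_class E (u @ word_inv w @ w @ v) = pres_class E (u @ v)"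
  "pres_class E (u @ w @ word_inv w @ v) = pres_class E (u @ v)"
  using pres_class_context[OF pres_class_word_inv[of E w], of u v]
    pres_class_context[OF pres_class_word_inv[of E "word_inv w"], of u v] by simp_all

lemma carrier_presented_group: "carrier (presented_group E) = range (pres_class E)"
  and one_presented_group: "\<one>\<^bsub>presented_group E\<^esub> = pres_class E []"
  by (simp_all add: presented_group_def)

lemma inv_presented_group: "inv\<^bsub>presented_group E\<^esub> pres_class E w = pres_class E (word_inv w)"
  by (rule group.inv_equality[OF group_presented_group])
    (auto simp: presented_group_mult carrier_presented_group one_presented_group pres_class_word_inv)

text \<open>This is used to tell classes apart: a value that no single step changes stays constant
  along the equivalence generated by the steps.\<close>

lemma pres_class_invariant:
  assumes "\<And>p q. pres_step E p q \<Longrightarrow> f p = f q" and "pres_class E p = pres_class E q"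
  shows "f p = f q"
proof -
  have "equivclp (pres_step E) p q" using assms(2) by (simp add: pres_class_eq_iff)
  then show ?thesis
    by (induction rule: equivclp_induct) (use assms(1) in metis)+
qed

section \<open>Traces of two by two matrices\<close>

lemma trace_2: "trace (A :: complex^2^2) = A$1$1 + A$2$2"
  by (simp add: trace_def sum_2)

text \<open>Polarising Cayley-Hamilton gives
  \<open>MN + NM = tr(M) N + tr(N) M + (tr(MN) - tr(M) tr(N)) 1\<close>; multiply by
  \<open>R\<close> on the left and take traces.\<close>

lemma trace_polarized_cayley_hamilton:
  fixes R M N :: "complex^2^2"
  shows "trace (R ** M ** N) + trace (R ** N ** M) =
    trace M * trace (R ** N) + trace N * trace (R ** M) + (trace (M ** N) - trace M * trace N) * trace R"
  by (simp add: trace_2 matrix_matrix_mult_def sum_2 algebra_simps)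

lemma trace_square:
  fixes R M :: "complex^2^2"
  shows "trace (R ** M ** M) = trace M * trace (R ** M) - det M * trace R"
  by (simp add: trace_2 matrix_matrix_mult_def sum_2 det_2 algebra_simps)

lemma trace_mult_commute: "trace (A ** B) = trace (B ** (A :: complex^2^2))"
  by (simp add: trace_2 matrix_matrix_mult_def sum_2 algebra_simps)

lemma trace_mat_1: "trace (mat 1 :: complex^2^2) = 2"
  by (simp add: trace_2 mat_def)

text \<open>Removing the scalar parts of \<open>A\<close> and \<open>B\<close> leaves traceless
  matrices that are isotropic and mutually orthogonal for the trace form. In this three-dimensional
  nondegenerate space such vectors are proportional, hence they commute.\<close>

lemma commute_if_nilpotent:
  fixes A B :: "complex^2^2"
  assumes "det A = 1" "det B = 1" "(trace A)\<^sup>2 = 4" "(trace B)\<^sup>2 = 4"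
    "2 * trace (A ** B) = trace A * trace B"
  shows "A ** B = B ** A"
proof -
  obtain a b c d where A: "A$1$1 = a" "A$1$2 = b" "A$2$1 = c" "A$2$2 = d" by blast
  obtain a' e f d' where B: "B$1$1 = a'" "B$1$2 = e" "B$2$1 = f" "B$2$2 = d'" by blast
  define p q where "p = a - d" and "q = a' - d'"
  have pq: "a = d + p" "a' = d' + q" by (simp_all add: p_def q_def)
  have 0: "a * d - b * c = 1" "a' * d' - e * f = 1" "(a + d)\<^sup>2 = 4" "(a' + d')\<^sup>2 = 4"
    "2 * (a * a' + b * f + (c * e + d * d')) = (a + d) * (a' + d')"
    using assms by (simp_all add: trace_2 matrix_matrix_mult_def sum_2 det_2 A B)
  have 1: "p * p + 4 * b * c = 0" "q * q + 4 * e * f = 0" "p * q + 2 * (b * f + c * e) = 0"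
    using 0 unfolding pq by Groebner_Basis.algebra+
  \<comment> \<open>Up to sign, this difference and the next two are the entries of
    \<open>AB - BA\<close>. Each has square zero and so vanishes.\<close>
  have "(b * f - c * e)\<^sup>2 = 0" using 1 by Groebner_Basis.algebra
  then have 2: "b * f = c * e" by simp
  have "(p * e - q * b)\<^sup>2 = 0" "(p * f - q * c)\<^sup>2 = 0" using 1 2 by Groebner_Basis.algebra+
  then have 3: "p * e = q * b" "p * f = q * c" by simp_all
  show ?thesis using 2 3
    by (simp add: vec_eq_iff forall_2 matrix_matrix_mult_def sum_2 A B pq algebra_simps)
qed

text \<open>Cayley-Hamilton reduces to \<open>B ** B = - mat 1\<close> here.\<close>

lemma trace_zero_power_4:
  fixes B :: "complex^2^2"
  assumes "det B = 1" "trace B = 0"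
  shows "B ** B ** B ** B = mat 1"
proof -
  obtain a e f d where B: "B$1$1 = a" "B$1$2 = e" "B$2$1 = f" "B$2$2 = d" by blast
  have "a * d - e * f = 1" "d + a = 0"
    using assms by (simp_all add: trace_2 det_2 B add.commute)
  then have "a * a + e * f = - 1" "a * e + e * d = 0" "f * a + d * f = 0" "f * e + d * d = - 1"
    by Groebner_Basis.algebra+
  then have "B ** B = - mat 1"
    by (simp add: vec_eq_iff forall_2 matrix_matrix_mult_def sum_2 mat_def B)
  then show ?thesis
    by (simp add: matrix_mul_assoc [symmetric])
      (simp add: vec_eq_iff forall_2 matrix_matrix_mult_def sum_2 mat_def)
qed

section \<open>Trace identities for words\<close>

lemma hom_SL2C_word:
  assumes \<rho>: "\<rho> \<in> hom (presented_group E) SL2C"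
  shows "\<rho> (pres_class E (p @ q)) = \<rho> (pres_class E p) ** \<rho> (pres_class E q)"
    and "det (\<rho> (pres_class E w)) = 1"
    and "\<rho> (pres_class E []) = mat 1"
proof -
  let ?M = "\<lambda>w. \<rho> (pres_class E w)"
  show mult: "?M (p @ q) = ?M p ** ?M q" for p q
    using hom_mult[OF \<rho>, of "pres_class E p" "pres_class E q"]
    by (simp add: carrier_presented_group presented_group_mult SL2C_def)
  show det: "det (?M w) = 1" for w
    using hom_in_carrier[OF \<rho>, of "pres_class E w"]
    by (simp add: carrier_presented_group SL2C_def)
  \<comment> \<open>The matrix of the empty word is idempotent, as \<open>[] @ [] = []\<close>, and
    invertible, as its determinant is one; so it is the identity.\<close>
  then obtain B where B: "B ** ?M [] = mat 1"
    by (metis invertible_det_nz invertible_def zero_neq_one)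
  have "?M [] = B ** (?M [] ** ?M [])"
    by (simp add: matrix_mul_assoc B)
  also have "\<dots> = mat 1" using mult[of "[]" "[]"] B by simp
  finally show "?M [] = mat 1" .
qed

locale presented_character =
  fixes E :: "('g word \<times> 'g word) set" and \<kappa> :: "'g word set \<Rightarrow> complex"
  assumes char: "\<kappa> \<in> char_variety (presented_group E)"
begin

definition c :: "'g word \<Rightarrow> complex" where "c w = \<kappa> (pres_class E w)"

lemma c_cong: "pres_class E p = pres_class E q \<Longrightarrow> c p = c q"
  by (simp add: c_def)

lemma representation:
  obtains M :: "'g word \<Rightarrow> complex^2^2" where "\<And>w. c w = trace (M w)"
    "\<And>p q. M (p @ q) = M p ** M q" "\<And>w. det (M w) = 1" "M [] = mat 1"
proof -
  obtain \<rho> where \<rho>: "\<rho> \<in> hom (presented_group E) SL2C" "\<kappa> = char_of (presented_group E) \<rho>"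
    using char by (auto simp: char_variety_def)
  have "\<kappa> (pres_class E w) = trace (\<rho> (pres_class E w))" for w
    by (simp add: \<rho>(2) char_of_def carrier_presented_group)
  then have "c w = trace (\<rho> (pres_class E w))" for w by (simp add: c_def)
  then show thesis using that[of "\<lambda>w. \<rho> (pres_class E w)"] hom_SL2C_word[OF \<rho>(1)] by blast
qed

lemma c_Nil: "c [] = 2"
proof -
  obtain M :: "'g word \<Rightarrow> complex^2^2" where M:
    "\<And>w. c w = trace (M w)" "\<And>p q. M (p @ q) = M p ** M q" "\<And>w. det (M w) = 1" "M [] = mat 1"
    by (rule representation) (rule that)
  then show ?thesis by (simp add: M trace_mat_1)
qed

lemma c_commute: "c (p @ q) = c (q @ p)"
proof -
  obtain M :: "'g word \<Rightarrow> complex^2^2" where M: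
    "\<And>w. c w = trace (M w)" "\<And>p q. M (p @ q) = M p ** M q" "\<And>w. det (M w) = 1" "M [] = mat 1"
    by (rule representation) (rule that)
  then show ?thesis by (simp add: M trace_mult_commute)
qed

lemma c_square: "c (p @ r @ r @ q) = c r * c (p @ r @ q) - c (p @ q)"
proof -
  obtain M :: "'g word \<Rightarrow> complex^2^2" where M:
    "\<And>w. c w = trace (M w)" "\<And>p q. M (p @ q) = M p ** M q" "\<And>w. det (M w) = 1" "M [] = mat 1"
    by (rule representation) (rule that)
  \<comment> \<open>Traces are cyclic, so \<open>q\<close> can be moved in front of
    \<open>p\<close>; the repeated factor then stands at the end, where \<open>trace_square\<close>
    applies.\<close>
  have "c ((q @ p) @ r @ r) = c r * c ((q @ p) @ r) - c (q @ p)"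
    using trace_square[of "M (q @ p)" "M r"] by (simp add: M matrix_mul_assoc)
  then show ?thesis
    using c_commute[of q "p @ r @ r"] c_commute[of q "p @ r"] c_commute[of q p] by simp
qed

lemma c_swap:
  "c (p @ r @ s @ q) = c r * c (p @ s @ q) + c s * c (p @ r @ q)
     + (c (r @ s) - c r * c s) * c (p @ q) - c (p @ s @ r @ q)"
proof -
  obtain M :: "'g word \<Rightarrow> complex^2^2" where M:
    "\<And>w. c w = trace (M w)" "\<And>p q. M (p @ q) = M p ** M q" "\<And>w. det (M w) = 1" "M [] = mat 1"
    by (rule representation) (rule that)
  have "c ((q @ p) @ r @ s) = c r * c ((q @ p) @ s) + c s * c ((q @ p) @ r)
     + (c (r @ s) - c r * c s) * c (q @ p) - c ((q @ p) @ s @ r)"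
    using trace_polarized_cayley_hamilton[of "M (q @ p)" "M r" "M s"]
    by (simp add: M matrix_mul_assoc eq_diff_eq)
  then show ?thesis
    using c_commute[of q "p @ r @ s"] c_commute[of q "p @ r"] c_commute[of q "p @ s"]
      c_commute[of q "p @ s @ r"] c_commute[of q p] by simp
qed

text \<open>Expanding \<open>RS\<close> by \<open>c_swap\<close> and the squares of \<open>R\<close>
  by \<open>c_square\<close> cancels all terms with \<open>c r\<close> and leaves
  \<open>RSR = S - tr(S) 1 + tr(SR) R\<close>.\<close>

lemma c_sandwich: "c (p @ r @ s @ r @ q) = c (p @ s @ q) - c s * c (p @ q) + c (s @ r) * c (p @ r @ q)"
  using c_swap[of p r s "r @ q"] c_square[of p r q] c_square[of "p @ s" r q] c_commute[of s r]
  unfolding append_assoc by Groebner_Basis.algebra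

text \<open>In determinant one, Cayley-Hamilton says that the inverse of \<open>R\<close> is
  \<open>tr(R) 1 - R\<close>.\<close>

lemma c_inv: "c (p @ word_inv r @ q) = c r * c (p @ q) - c (p @ r @ q)"
proof -
  have "c (p @ word_inv r @ r @ r @ q) = c (p @ r @ q)" "c (p @ word_inv r @ r @ q) = c (p @ q)"
    by (rule c_cong, rule pres_class_cancel)+
  then show ?thesis using c_square[of "p @ word_inv r" r q] by simp
qed

lemma c_word_inv: "c (word_inv w) = c w"
  using c_inv[of "[]" w "[]"] by (simp add: c_Nil)

lemma c_conj: "c (p @ w @ word_inv p) = c w"
proof -
  have "c (p @ w @ word_inv p) = c ((w @ word_inv p) @ p)" by (rule c_commute)
  also have "\<dots> = c w"
    by (rule c_cong) (use pres_class_cancel(1)[of E w p "[]"] in simp)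
  finally show ?thesis .
qed

end

text \<open>\<open>S\<close> is a subring of functions that need not be restricted to
  \<open>X\<close>; \<open>cong\<close> makes membership depend only on the values on
  \<open>X\<close>. Later \<open>S\<close> is the span of the seventeen elements.\<close>

locale trace_subring =
  fixes E :: "('g word \<times> 'g word) set" and X :: "('g word set \<Rightarrow> complex) set"
    and S :: "(('g word set \<Rightarrow> complex) \<Rightarrow> complex) set"
  assumes X: "X \<subseteq> char_variety (presented_group E)"
    and one: "(\<lambda>_. 1) \<in> S"
    and diff: "f \<in> S \<Longrightarrow> g \<in> S \<Longrightarrow> (\<lambda>\<kappa>. f \<kappa> - g \<kappa>) \<in> S"
    and mult: "f \<in> S \<Longrightarrow> g \<in> S \<Longrightarrow> (\<lambda>\<kappa>. f \<kappa> * g \<kappa>) \<in> S"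
    and cong: "f \<in> S \<Longrightarrow> (\<And>\<kappa>. \<kappa> \<in> X \<Longrightarrow> g \<kappa> = f \<kappa>) \<Longrightarrow> g \<in> S"
begin

lemma add: "f \<in> S \<Longrightarrow> g \<in> S \<Longrightarrow> (\<lambda>\<kappa>. f \<kappa> + g \<kappa>) \<in> S"
  using diff[of f "\<lambda>\<kappa>. 0 - g \<kappa>"] diff[OF diff[OF one one], of g] by simp

definition tr :: "'g word \<Rightarrow> ('g word set \<Rightarrow> complex) \<Rightarrow> complex" where
  "tr w = (\<lambda>\<kappa>. \<kappa> (pres_class E w))"

lemma character: "\<kappa> \<in> X \<Longrightarrow> presented_character E \<kappa>"
  using X by unfold_locales auto

lemma tr_c: "\<kappa> \<in> X \<Longrightarrow> tr w \<kappa> = presented_character.c E \<kappa> w"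
  by (simp add: tr_def presented_character.c_def[OF character])

lemma tr_Nil: "tr [] \<in> S"
  by (rule cong[OF add[OF one one]]) (simp add: tr_c presented_character.c_Nil[OF character])

lemma tr_commute: "tr (p @ q) \<in> S \<Longrightarrow> tr (q @ p) \<in> S"
  by (erule cong) (simp only: tr_c, rule presented_character.c_commute[OF character])

lemma tr_square:
  assumes "tr r \<in> S" "tr (p @ r @ q) \<in> S" "tr (p @ q) \<in> S"
  shows "tr (p @ r @ r @ q) \<in> S"
  by (rule cong[OF diff[OF mult[OF assms(1,2)] assms(3)]])
    (simp only: tr_c, rule presented_character.c_square[OF character])

lemma tr_swap:
  assumes "tr r \<in> S" "tr s \<in> S" "tr (s @ r) \<in> S"
    and "tr (p @ s @ q) \<in> S" "tr (p @ r @ q) \<in> S" "tr (p @ q) \<in> S" "tr (p @ s @ r @ q) \<in> S"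
  shows "tr (p @ r @ s @ q) \<in> S"
  by (rule cong[OF diff[OF add[OF add[OF mult[OF assms(1,4)] mult[OF assms(2,5)]]
        mult[OF diff[OF tr_commute[OF assms(3)] mult[OF assms(1,2)]] assms(6)]] assms(7)]])
    (simp only: tr_c, rule presented_character.c_swap[OF character])

lemma tr_sandwich:
  assumes "tr s \<in> S" "tr (s @ r) \<in> S"
    and "tr (p @ s @ q) \<in> S" "tr (p @ q) \<in> S" "tr (p @ r @ q) \<in> S"
  shows "tr (p @ r @ s @ r @ q) \<in> S"
  by (rule cong[OF add[OF diff[OF assms(3) mult[OF assms(1,4)]] mult[OF assms(2,5)]]])
    (simp only: tr_c, rule presented_character.c_sandwich[OF character])

lemma tr_inv:
  assumes "tr r \<in> S" "tr (p @ q) \<in> S" "tr (p @ r @ q) \<in> S"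
  shows "tr (p @ word_inv r @ q) \<in> S"
  by (rule cong[OF diff[OF mult[OF assms(1,2)] assms(3)]])
    (simp only: tr_c, rule presented_character.c_inv[OF character])

text \<open>Over the ring generated by the seven traces below, the matrices \<open>1, A, B, C, AB, AC, BC, ABC\<close>
  span a module that is stable under left multiplication by \<open>A\<close>, \<open>B\<close> and \<open>C\<close>.\<close>

lemma tr_word:
  assumes gens: "\<And>g. g = a \<or> g = b \<or> g = c"
    and traces: "tr [(a, True)] \<in> S" "tr [(b, True)] \<in> S" "tr [(c, True)] \<in> S"
      "tr [(a, True), (b, True)] \<in> S" "tr [(a, True), (c, True)] \<in> S" "tr [(b, True), (c, True)] \<in> S"
      "tr [(a, True), (b, True), (c, True)] \<in> S"
  shows "tr w \<in> S"
proof -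
  let ?A = "(a, True)" and ?B = "(b, True)" and ?C = "(c, True)"
  define mon where "mon = {[], [?A], [?B], [?C], [?A, ?B], [?A, ?C], [?B, ?C], [?A, ?B, ?C]}"
  \<comment> \<open>The claim is strengthened to words followed by any of the eight monomials, so
    that the last letter of \<open>w\<close> can be absorbed into the monomial.\<close>
  have "\<forall>m\<in>mon. tr (w @ m) \<in> S"
  proof (induction w rule: rev_induct)
    case Nil
    show ?case using traces tr_Nil by (simp add: mon_def)
  next
    case (snoc s w)
    have m: "tr (w @ [?A]) \<in> S" "tr (w @ [?B]) \<in> S" "tr (w @ [?C]) \<in> S" "tr (w @ [?A, ?B]) \<in> S"
      "tr (w @ [?A, ?C]) \<in> S" "tr (w @ [?B, ?C]) \<in> S" "tr (w @ [?A, ?B, ?C]) \<in> S" "tr w \<in> S"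
      using snoc.IH by (simp_all add: mon_def)
    have A: "tr (w @ [?A] @ m) \<in> S" if "m \<in> mon" for m
      using that m tr_square[of "[?A]" w "[]"] tr_square[of "[?A]" w "[?B]"]
        tr_square[of "[?A]" w "[?C]"] tr_square[of "[?A]" w "[?B, ?C]"] traces
      by (auto simp: mon_def)
    \<comment> \<open>\<open>B\<close> is exchanged with a following \<open>A\<close> by
      \<open>tr_swap\<close>; a pattern \<open>BAB\<close> is removed by \<open>tr_sandwich\<close>,
      and \<open>BB\<close> by \<open>tr_square\<close>.\<close>
    have B: "tr (w @ [?B] @ m) \<in> S" if "m \<in> mon" for m
      using that m tr_square[of "[?B]" w "[]"] tr_square[of "[?B]" w "[?C]"]
        tr_swap[of "[?B]" "[?A]" w "[]"] tr_swap[of "[?B]" "[?A]" w "[?C]"]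
        tr_sandwich[of "[?A]" "[?B]" w "[]"] tr_sandwich[of "[?A]" "[?B]" w "[?C]"] traces
      by (auto simp: mon_def)
    \<comment> \<open>The same reductions work for \<open>C\<close>, with the block
      \<open>AB\<close> also treated as a single factor.\<close>
    have C: "tr (w @ [?C] @ m) \<in> S" if "m \<in> mon" for m
      using that m tr_square[of "[?C]" w "[]"] tr_swap[of "[?C]" "[?A]" w "[]"]
        tr_swap[of "[?C]" "[?B]" w "[]"] tr_swap[of "[?C]" "[?A, ?B]" w "[]"]
        tr_sandwich[of "[?A]" "[?C]" w "[]"] tr_sandwich[of "[?B]" "[?C]" w "[]"]
        tr_sandwich[of "[?A, ?B]" "[?C]" w "[]"] traces
      by (auto simp: mon_def)
    have pos: "tr (w @ [(g, True)] @ m) \<in> S" if "m \<in> mon" for g m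
      using gens[of g] A[OF that] B[OF that] C[OF that] by auto
    have gen: "tr [(g, True)] \<in> S" for g
      using gens[of g] traces by auto
    obtain g \<epsilon> where s: "s = (g, \<epsilon>)" by fastforce
    show ?case
    proof
      fix m assume "m \<in> mon"
      with tr_inv[of "[(g, True)]" w m] show "tr ((w @ [s]) @ m) \<in> S"
        using pos gen snoc.IH by (cases \<epsilon>) (auto simp: s word_inv_def)
    qed
  qed
  then show ?thesis by (simp add: mon_def)
qed

end

section \<open>Trace relations from the presentation\<close>

abbreviation "pa \<equiv> (Alpha, True)"
abbreviation "pb \<equiv> (Beta, True)"
abbreviation "pt \<equiv> (Tau, True)"

lemma tau_alpha:
  "pres_class N_relations [pt, pa] = pres_class N_relations (word_inv [pb, pa, pb] @ [pt])"
proof -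
  let ?C = "pres_class N_relations"
  have "?C ([pt, pa] @ word_inv [pt]) = ?C (word_inv [pb, pa, pb])"
    by (rule pres_class_relation) (simp add: N_relations_def Let_def)
  then have "?C ([pt, pa] @ word_inv [pt] @ [pt]) = ?C (word_inv [pb, pa, pb] @ [pt])"
    using pres_class_context[of N_relations "[pt, pa] @ word_inv [pt]" _ "[]" "[pt]"] by simp
  then show ?thesis using pres_class_cancel(1)[of N_relations "[pt, pa]" "[pt]" "[]"] by simp
qed

text \<open>Let \<open>g\<close> be the inverse of \<open>\<beta>\<alpha>\<beta>\<close>. Then
  \<open>\<beta> g \<beta>\<alpha> = 1\<close>, and \<open>g \<tau> = \<tau>\<alpha>\<close> by the
  first relation. Hence \<open>\<beta>\<tau>\<alpha>\<beta> = \<beta> g \<tau>\<beta> = \<beta> g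
  \<beta>\<alpha> g^3 \<tau> = g^3 \<tau> = \<tau>\<alpha>^3\<close>, a form of the second relation
  without inverses.\<close>

lemma beta_tau:
  "pres_class N_relations [pb, pt, pa, pb] = pres_class N_relations [pt, pa, pa, pa]"
proof -
  let ?C = "pres_class N_relations" and ?g = "word_inv [pb, pa, pb]"
  have "?C ([pt, pb] @ word_inv [pt]) = ?C ([pb, pa] @ ?g @ ?g @ ?g)"
    by (rule pres_class_relation) (simp add: N_relations_def Let_def numeral_3_eq_3)
  then have "?C ([pt, pb] @ word_inv [pt] @ [pt]) = ?C ([pb, pa] @ ?g @ ?g @ ?g @ [pt])"
    using pres_class_context[of N_relations "[pt, pb] @ word_inv [pt]" _ "[]" "[pt]"] by simp
  then have 1: "?C [pt, pb] = ?C ([pb, pa] @ ?g @ ?g @ ?g @ [pt])"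
    using pres_class_cancel(1)[of N_relations "[pt, pb]" "[pt]" "[]"] by simp
  have g: "?C (p @ ?g @ [pt] @ q) = ?C (p @ [pt, pa] @ q)" for p q
    using pres_class_context[OF tau_alpha, of p q] by simp
  have "?C [pb, pt, pa, pb] = ?C ([pb] @ ?g @ [pt] @ [pb])" using g[of "[pb]" "[pb]"] by simp
  also have "\<dots> = ?C ([pb] @ ?g @ [pb, pa] @ ?g @ ?g @ ?g @ [pt])"
    using pres_class_context[OF 1, of "[pb] @ ?g" "[]"] by simp
  also have "\<dots> = ?C ([pb] @ word_inv [pb] @ word_inv [pb, pa] @ [pb, pa] @ ?g @ ?g @ ?g @ [pt])"
    by (simp add: word_inv_def)
  also have "\<dots> = ?C (?g @ ?g @ ?g @ [pt])"
    using pres_class_cancel(2)[of N_relations "[]" "[pb]" "word_inv [pb, pa] @ [pb, pa] @ ?g @ ?g @ ?g @ [pt]"]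
      pres_class_cancel(1)[of N_relations "[]" "[pb, pa]" "?g @ ?g @ ?g @ [pt]"] by simp
  also have "\<dots> = ?C [pt, pa, pa, pa]"
    using g[of "?g @ ?g" "[]"] g[of ?g "[pa]"] g[of "[]" "[pa, pa]"] by simp
  finally show ?thesis .
qed

section \<open>Trace relations for characters of the group of N\<close>

locale N_character = presented_character N_relations \<kappa> for \<kappa>
begin

lemma c_tau_alpha: "c (p @ word_inv [pb, pa, pb] @ [pt] @ q) = c (p @ [pt, pa] @ q)"
  by (rule c_cong) (use pres_class_context[OF tau_alpha, of p q] in simp)

lemma c_cancel: "c (u @ word_inv w @ w @ v) = c (u @ v)" "c (u @ w @ word_inv w @ v) = c (u @ v)"
  by (rule c_cong, rule pres_class_cancel)+

text \<open>The first relation makes \<alpha> conjugate to the inverse of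
  \<open>\<beta>\<alpha>\<beta>\<close>, and inverse elements have equal traces.\<close>

lemma trace_alpha: "c [pb] * c [pa, pb] = 2 * c [pa]"
proof -
  have "c [pa] = c ([pt] @ [pa] @ word_inv [pt])" by (rule c_conj[symmetric])
  also have "\<dots> = c (word_inv [pb, pa, pb] @ [pt] @ word_inv [pt])"
    using c_tau_alpha[of "[]" "word_inv [pt]"] by simp
  also have "\<dots> = c [pb, pa, pb]"
    using c_cancel(2)[of "word_inv [pb, pa, pb]" "[pt]" "[]"] by (simp add: c_word_inv)
  also have "\<dots> = c [pa] - c [pa] * c [] + c [pa, pb] * c [pb]"
    using c_sandwich[of "[]" "[pb]" "[pa]" "[]"] by simp
  finally show ?thesis by (simp add: c_Nil)
qed

lemma trace_powers:
  "c [pa, pa] = (c [pa])\<^sup>2 - 2"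
  "c [pa, pa, pa] = c [pa] * c [pa, pa] - c [pa]"
  "c ([pa, pa] @ q) = c [pa] * c (pa # q) - c q"
  using c_square[of "[]" "[pa]" "[]"] c_square[of "[]" "[pa]" "[pa]"] c_square[of "[]" "[pa]" q]
  by (simp_all add: c_Nil power2_eq_square)

text \<open>By \<open>beta_tau\<close>, \<beta> is conjugate under \<tau> to
  \<open>\<alpha>^3 (\<alpha>\<beta>)^-1\<close>; the relation compares the two traces.\<close>

lemma trace_beta: "(c [pa])\<^sup>2 * c [pb] - c [pa] * c [pa, pb] = 2 * c [pb]"
proof -
  have "c [pb] = c ([pb] @ [pt, pa, pb] @ word_inv [pt, pa, pb])"
    using c_cancel(2)[of "[pb]" "[pt, pa, pb]" "[]"] by simp
  also have "\<dots> = c ([pt, pa, pa, pa] @ word_inv [pt, pa, pb])"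
    by (rule c_cong) (use pres_class_context[OF beta_tau, of "[]" "word_inv [pt, pa, pb]"] in simp)
  also have "\<dots> = c ([pt] @ ([pa, pa, pa] @ word_inv [pa, pb]) @ word_inv [pt])"
    by (simp add: word_inv_def)
  also have "\<dots> = c ([pa, pa, pa] @ word_inv [pa, pb])" by (rule c_conj)
  also have "\<dots> = c [pa, pb] * c [pa, pa, pa] - c [pa, pa, pa, pa, pb]"
    using c_inv[of "[pa, pa, pa]" "[pa, pb]" "[]"] by simp
  finally show ?thesis
    using trace_powers(1,2) trace_powers(3)[of "[pa, pa, pb]"] trace_powers(3)[of "[pa, pb]"]
      trace_powers(3)[of "[pb]"] unfolding append.simps by Groebner_Basis.algebra
qed

text \<open>This is Fricke's identity; it ties \<open>l\<close> to \<open>x\<close>,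
  \<open>y\<close> and \<open>z\<close>.\<close>

lemma trace_commutator:
  "c ([pa, pb] @ word_inv [pa] @ word_inv [pb]) =
    (c [pa])\<^sup>2 + (c [pb])\<^sup>2 + (c [pa, pb])\<^sup>2 - c [pa] * c [pb] * c [pa, pb] - 2"
proof -
  have "c ([pa, pb] @ word_inv [pa] @ word_inv [pb]) = c [pa] * c [pa] - c ([pa, pb, pa] @ word_inv [pb])"
    using c_inv[of "[pa, pb]" "[pa]" "word_inv [pb]"] c_cancel(2)[of "[pa]" "[pb]" "[]"] by simp
  moreover have "c ([pa, pb, pa] @ word_inv [pb]) = c [pb] * c [pa, pb, pa] - c [pa, pb, pa, pb]"
    using c_inv[of "[pa, pb, pa]" "[pb]" "[]"] by simp
  moreover have "c [pa, pb, pa] = c [pa, pa, pb]"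
    using c_commute[of "[pa, pb]" "[pa]"] by simp
  moreover have "c [pa, pb, pa, pb] = c [pa, pb] * c [pa, pb] - 2"
    using c_square[of "[]" "[pa, pb]" "[]"] by (simp add: c_Nil)
  ultimately show ?thesis
    using trace_powers(3)[of "[pb]"] unfolding append.simps by Groebner_Basis.algebra
qed

text \<open>Cyclic rotation turns \<open>\<alpha>\<alpha>\<beta>\<tau>\<close> into
  \<open>\<alpha>\<beta>\<tau>\<alpha>\<close>, which \<open>tau_alpha\<close> collapses to
  \<open>\<beta>^-1 \<tau>\<close>; the first and last words are expanded in traces.\<close>

lemma trace_alpha_beta_tau: "c [pa] * c [pa, pb, pt] = c [pb] * c [pt]"
proof -
  have "c [pa] * c [pa, pb, pt] - c [pb, pt] = c [pa, pa, pb, pt]"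
    using trace_powers(3)[of "[pb, pt]"] by simp
  also have "\<dots> = c ([pa, pb] @ [pt, pa])"
    using c_commute[of "[pa]" "[pa, pb, pt]"] by simp
  also have "\<dots> = c ([pa, pb] @ word_inv [pa, pb] @ word_inv [pb] @ [pt])"
    using c_tau_alpha[of "[pa, pb]" "[]"] by (simp add: word_inv_def)
  also have "\<dots> = c (word_inv [pb] @ [pt])"
    using c_cancel(2)[of "[]" "[pa, pb]"] by simp
  also have "\<dots> = c [pb] * c [pt] - c [pb, pt]"
    using c_inv[of "[]" "[pb]" "[pt]"] by simp
  finally show ?thesis by simp
qed

text \<open>Cyclic rotation turns \<open>\<alpha>\<beta>\<tau>\<close> into
  \<open>\<beta>\<tau>\<alpha>\<close>, which equals \<open>(\<beta>\<alpha>)^-1 \<tau>\<close> by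
  \<open>tau_alpha\<close>.\<close>

lemma trace_beta_tau: "c [pa] * c [pb, pt] + c [pb] * c [pa, pt] = c [pa] * c [pb] * c [pt]"
proof -
  have "c [pa, pb, pt] = c ([pb] @ [pt, pa])"
    using c_commute[of "[pa]" "[pb, pt]"] by simp
  also have "\<dots> = c ([pb] @ word_inv [pb] @ word_inv [pb, pa] @ [pt])"
    using c_tau_alpha[of "[pb]" "[]"] by (simp add: word_inv_def)
  also have "\<dots> = c (word_inv [pb, pa] @ [pt])"
    using c_cancel(2)[of "[]" "[pb]"] by simp
  also have "\<dots> = c [pb, pa] * c [pt] - c [pb, pa, pt]"
    using c_inv[of "[]" "[pb, pa]" "[pt]"] by simp
  also have "c [pb, pa, pt] = c [pb] * c [pa, pt] + c [pa] * c [pb, pt]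
      + (c [pb, pa] - c [pb] * c [pa]) * c [pt] - c [pa, pb, pt]"
    using c_swap[of "[]" "[pb]" "[pa]" "[pt]"] by simp
  finally show ?thesis by Groebner_Basis.algebra
qed

text \<open>Both sides of \<open>beta_tau\<close> have the same trace; each is reduced by
  Cayley-Hamilton.\<close>

lemma trace_alpha_cubed_tau:
  "c [pb] * c [pa, pb, pt] = (c [pa])\<^sup>2 * c [pa, pt] - c [pa] * c [pt]"
proof -
  have "c [pb] * c [pa, pb, pt] - c [pa, pt] = c ([pa, pb] @ [pb, pt])"
    using c_square[of "[pa]" "[pb]" "[pt]"] by simp
  also have "\<dots> = c [pb, pt, pa, pb]" using c_commute[of "[pa, pb]" "[pb, pt]"] by simp
  also have "\<dots> = c ([pt] @ [pa, pa, pa])" by (rule c_cong) (simp add: beta_tau)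
  also have "\<dots> = c [pa, pa, pa, pt]" using c_commute[of "[pt]" "[pa, pa, pa]"] by simp
  also have "\<dots> = c [pa] * (c [pa] * c [pa, pt] - c [pt]) - c [pa, pt]"
    using trace_powers(3)[of "[pa, pt]"] trace_powers(3)[of "[pt]"] by simp
  finally show ?thesis by (simp add: algebra_simps power2_eq_square)
qed

text \<open>The trace of \<open>(\<alpha>\<tau>)^2\<close> is computed twice: as that of a square,
  and, after \<open>tau_alpha\<close>, as that of \<open>\<alpha> g \<tau>\<tau>\<close> with
  \<open>g\<close> the inverse of \<open>\<beta>\<alpha>\<beta>\<close>.\<close>

lemma trace_alpha_tau_square:
  "(c [pa, pt])\<^sup>2 = c [pa] * c [pt] * c [pa, pt] - (c [pt])\<^sup>2 - (c [pb])\<^sup>2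
     + c ([pa, pb] @ word_inv [pa] @ word_inv [pb]) + 2"
proof -
  let ?g = "word_inv [pb, pa, pb]" and ?l = "c ([pa, pb] @ word_inv [pa] @ word_inv [pb])"
  have "c [pa, pt, pa, pt] = (c [pa, pt])\<^sup>2 - 2"
    using c_square[of "[]" "[pa, pt]" "[]"] by (simp add: c_Nil power2_eq_square)
  moreover have "c [pa, pt, pa, pt] = c ([pa] @ ?g @ [pt] @ [pt])"
    using c_tau_alpha[of "[pa]" "[pt]"] by simp
  moreover have "c ([pa] @ ?g @ [pt] @ [pt]) = c [pt] * c ([pa] @ ?g @ [pt]) - c ([pa] @ ?g)"
    using c_square[of "[pa] @ ?g" "[pt]" "[]"] by simp
  moreover have "c ([pa] @ ?g @ [pt]) = c [pa] * c [pa, pt] - c [pt]"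
    using c_tau_alpha[of "[pa]" "[]"] c_commute[of "[pa, pt]" "[pa]"] trace_powers(3)[of "[pt]"] by simp
  \<comment> \<open>The word is \<open>\<alpha>\<beta>^-1\<alpha>^-1\<beta>^-1\<close>. Flipping its
    last letter yields a rotation of the inverse commutator, of trace \<open>?l\<close>; dropping
    that letter leaves a conjugate of \<open>\<beta>^-1\<close>.\<close>
  moreover have "c ([pa] @ ?g) = c [pb] * c [pb] - ?l"
  proof -
    have "c ([pa] @ ?g) = c (([pa] @ word_inv [pb] @ word_inv [pa]) @ word_inv [pb])"
      by (simp add: word_inv_def)
    also have "\<dots> = c [pb] * c ([pa] @ word_inv [pb] @ word_inv [pa])
        - c ([pa] @ word_inv [pb] @ word_inv [pa] @ [pb])"
      using c_inv[of "[pa] @ word_inv [pb] @ word_inv [pa]" "[pb]" "[]"] by simp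
    also have "c ([pa] @ word_inv [pb] @ word_inv [pa]) = c [pb]"
      by (simp only: c_conj c_word_inv)
    also have "c ([pa] @ word_inv [pb] @ word_inv [pa] @ [pb]) = ?l"
      using c_commute[of "[pb]" "[pa] @ word_inv [pb] @ word_inv [pa]"]
        c_word_inv[of "[pa, pb] @ word_inv [pa] @ word_inv [pb]"]
      by (simp add: word_inv_def)
    finally show ?thesis .
  qed
  ultimately show ?thesis by Groebner_Basis.algebra
qed

end

section \<open>A finite quotient and the trace of beta at a faithful character\<close>

text \<open>The quotient onto the symmetric group on the three-element type \<open>letter\<close> in which \<open>\<alpha>\<close> is a
  transposition, \<open>\<beta>\<close> a \<open>3\<close>-cycle and \<open>\<tau>\<close> trivial.\<close>

fun s3_action :: "letter \<times> bool \<Rightarrow> letter \<Rightarrow> letter" where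
  "s3_action (Alpha, \<epsilon>) s = (case s of Alpha \<Rightarrow> Alpha | Beta \<Rightarrow> Tau | Tau \<Rightarrow> Beta)"
| "s3_action (Beta, True) s = (case s of Alpha \<Rightarrow> Beta | Beta \<Rightarrow> Tau | Tau \<Rightarrow> Alpha)"
| "s3_action (Beta, False) s = (case s of Alpha \<Rightarrow> Tau | Beta \<Rightarrow> Alpha | Tau \<Rightarrow> Beta)"
| "s3_action (Tau, \<epsilon>) s = s"

lemma s3_action_invariant:
  assumes "pres_class N_relations p = pres_class N_relations q"
  shows "foldr s3_action p s = foldr s3_action q s"
proof (rule pres_class_invariant[OF _ assms])
  fix p q assume "pres_step N_relations p q"
  then show "foldr s3_action p s = foldr s3_action q s"
  proof cases
    case (cancel u g b v)
    have "s3_action (g, b) (s3_action (g, \<not> b) s) = s" for s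
      by (cases g; cases b; cases s) simp_all
    then show ?thesis using cancel by simp
  next
    case (relation p' q' u v)
    have "foldr s3_action p' s = foldr s3_action q' s" for s
      using relation(3)
      by (cases s) (auto simp: N_relations_def Let_def word_inv_def numeral_3_eq_3)
    then show ?thesis using relation by simp
  qed
qed

text \<open>In the permutation quotient \<open>\<beta>^4\<close> acts as the 3-cycle \<beta>
  itself.\<close>

lemma beta_power_4: "pres_class N_relations [pb, pb, pb, pb] \<noteq> pres_class N_relations []"
  using s3_action_invariant[of "[pb, pb, pb, pb]" "[]" Alpha] by auto

lemma alpha_beta_not_commute: "pres_class N_relations [pa, pb] \<noteq> pres_class N_relations [pb, pa]"
  using s3_action_invariant[of "[pa, pb]" "[pb, pa]" Alpha] by auto

text \<open>When \<open>y\<close> is 2 or -2, the relations in \<open>x\<close>, \<open>y\<close>,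
  \<open>z\<close> force exactly the trace conditions of \<open>commute_if_nilpotent\<close> on the
  pair \<alpha>, \<beta>.\<close>

lemma trace_beta_square_4:
  fixes x y z :: complex
  assumes "y * z = 2 * x" "x\<^sup>2 * y - x * z = 2 * y" "y\<^sup>2 = 4"
  shows "x\<^sup>2 = 4 \<and> 2 * z = x * y"
proof -
  have "4 * z = y * (y * z)" using assms(3) by (simp add: power2_eq_square flip: mult.assoc)
  then have "2 * z = x * y" by (simp add: assms(1))
  have "2 * x\<^sup>2 = x\<^sup>2 * y\<^sup>2 - x * (y * z)"
    unfolding assms(1,3) by (simp add: power2_eq_square)
  also have "\<dots> = y * (x\<^sup>2 * y - x * z)" by (simp add: algebra_simps power2_eq_square)
  also have "\<dots> = 2 * y\<^sup>2" unfolding assms(2) by (simp add: power2_eq_square)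
  finally show ?thesis using \<open>2 * z = x * y\<close> assms(3) by simp
qed

text \<open>This supplies a point of the curve where \<open>y (y^2 - 4)\<close> is nonzero, which is
  what makes this factor cancellable there.\<close>

lemma faithful_trace_beta:
  assumes \<rho>: "\<rho> \<in> hom pi1N SL2C" and inj: "inj_on \<rho> (carrier pi1N)"
  shows "char_of pi1N \<rho> \<beta> \<noteq> 0" and "(char_of pi1N \<rho> \<beta>)\<^sup>2 \<noteq> 4"
proof -
  let ?\<kappa> = "char_of pi1N \<rho>" and ?C = "pres_class N_relations"
  interpret N_character ?\<kappa>
    by unfold_locales (use \<rho> in \<open>auto simp: char_variety_def pi1N_def\<close>)
  define M where "M w = \<rho> (?C w)" for w
  have car: "?C w \<in> carrier pi1N" for w by (simp add: pi1N_def carrier_presented_group)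
  have "?\<kappa> (?C w) = trace (M w)" for w using car by (simp add: char_of_def M_def)
  then have tr: "c w = trace (M w)" for w by (simp add: c_def)
  note M = hom_SL2C_word[OF \<rho>[unfolded pi1N_def], folded M_def]
  have ne: "M p \<noteq> M q" if "?C p \<noteq> ?C q" for p q
    using inj_onD[OF inj _ car car] that by (auto simp: M_def)
  have \<beta>: "?\<kappa> \<beta> = c [pb]" by (simp add: c_def \<beta>_def pres_gen_def)
  show "?\<kappa> \<beta> \<noteq> 0"
  proof
    assume "?\<kappa> \<beta> = 0"
    then have 0: "trace (M [pb]) = 0" using \<beta> tr by metis
    have "M [pb, pb, pb, pb] = M [pb] ** M [pb] ** M [pb] ** M [pb]"
      using M(1)[of "[pb]" "[pb]"] M(1)[of "[pb, pb]" "[pb]"] M(1)[of "[pb, pb, pb]" "[pb]"] by simp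
    also have "\<dots> = M []" using trace_zero_power_4[OF M(2) 0] M(3) by simp
    finally show False using ne[OF beta_power_4] by simp
  qed
  show "(?\<kappa> \<beta>)\<^sup>2 \<noteq> 4"
  proof
    assume "(?\<kappa> \<beta>)\<^sup>2 = 4"
    then have 4: "(c [pb])\<^sup>2 = 4" by (simp only: \<beta>)
    have "(c [pa])\<^sup>2 = 4 \<and> 2 * c [pa, pb] = c [pa] * c [pb]"
      using trace_alpha trace_beta 4 by (rule trace_beta_square_4)
    then have "(trace (M [pa]))\<^sup>2 = 4" "2 * trace (M [pa] ** M [pb]) = trace (M [pa]) * trace (M [pb])"
      using M(1)[of "[pa]" "[pb]"] by (simp_all only: tr append.simps)
    then have "M [pa] ** M [pb] = M [pb] ** M [pa]"
      using 4 by (intro commute_if_nilpotent M(2)) (simp_all only: tr)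
    then have "M [pa, pb] = M [pb, pa]"
      using M(1)[of "[pa]" "[pb]"] M(1)[of "[pb]" "[pa]"] by simp
    then show False using ne[OF alpha_beta_not_commute] by simp
  qed
qed

section \<open>Spans over the integral polynomials in one function\<close>

text \<open>Closure under sums, signs and multiplication by \<open>l\<close> replaces an explicit
  ring of integral polynomials in \<open>l\<close>. The rule \<open>cong\<close> identifies
  functions that agree on \<open>X\<close>.\<close>

inductive_set zspan :: "'k set \<Rightarrow> ('k \<Rightarrow> complex) \<Rightarrow> ('k \<Rightarrow> complex) set \<Rightarrow> ('k \<Rightarrow> complex) set"
  for X l B where
  zero: "(\<lambda>_. 0) \<in> zspan X l B"
| base: "f \<in> B \<Longrightarrow> f \<in> zspan X l B"
| add: "f \<in> zspan X l B \<Longrightarrow> g \<in> zspan X l B \<Longrightarrow> (\<lambda>k. f k + g k) \<in> zspan X l B"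
| uminus: "f \<in> zspan X l B \<Longrightarrow> (\<lambda>k. - f k) \<in> zspan X l B"
| mult: "f \<in> zspan X l B \<Longrightarrow> (\<lambda>k. l k * f k) \<in> zspan X l B"
| cong: "f \<in> zspan X l B \<Longrightarrow> (\<And>k. k \<in> X \<Longrightarrow> g k = f k) \<Longrightarrow> g \<in> zspan X l B"

lemma zspan_cong: "(\<And>k. k \<in> X \<Longrightarrow> g k = f k) \<Longrightarrow> f \<in> zspan X l B \<Longrightarrow> g \<in> zspan X l B"
  by (rule zspan.cong)

lemma zspan_diff:
  "f \<in> zspan X l B \<Longrightarrow> g \<in> zspan X l B \<Longrightarrow> (\<lambda>k. f k - g k) \<in> zspan X l B"
  using zspan.add[OF _ zspan.uminus, of f X l B g] by simp

lemma zspan_of_nat: "f \<in> zspan X l B \<Longrightarrow> (\<lambda>k. of_nat n * f k) \<in> zspan X l B"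
proof (induction n)
  case 0
  then show ?case using zspan.zero by simp
next
  case (Suc n)
  then show ?case using zspan.add[of f X l B "\<lambda>k. of_nat n * f k"] by (simp add: distrib_right)
qed

lemma zspan_numeral: "f \<in> zspan X l B \<Longrightarrow> (\<lambda>k. numeral n * f k) \<in> zspan X l B"
  using zspan_of_nat[of f X l B "numeral n"] by simp

text \<open>Multiplication by a fixed function commutes with all operations that build the span, so
  generators suffice. The target span may differ from the source, as is needed for sending
  \<open>J\<close> into \<open>E\<close>.\<close>

lemma zspan_mult_left:
  assumes "f \<in> zspan X l B" and "\<And>b. b \<in> B \<Longrightarrow> (\<lambda>k. g k * b k) \<in> zspan X l C"
  shows "(\<lambda>k. g k * f k) \<in> zspan X l C"
  using assms(1)
proof induction
  case zero
  show ?case using zspan.zero by simp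
next
  case (base f)
  then show ?case by (rule assms(2))
next
  case (add f h)
  then show ?case using zspan.add[OF add.IH] by (simp add: distrib_left)
next
  case (uminus f)
  then show ?case using zspan.uminus[OF uminus.IH] by simp
next
  case (mult f)
  then show ?case using zspan.mult[OF mult.IH] by (simp add: mult.left_commute)
next
  case (cong f h)
  show ?case by (rule zspan.cong[OF cong.IH]) (simp add: cong.hyps)
qed

lemma zspan_mono:
  assumes "B \<subseteq> C" "f \<in> zspan X l B"
  shows "f \<in> zspan X l C"
  using zspan_mult_left[OF assms(2), of "\<lambda>_. 1"] assms(1) by (auto intro: zspan.base)

text \<open>The splitting is asserted on \<open>X\<close> only, since \<open>cong\<close> leaves
  values elsewhere arbitrary.\<close>

lemma zspan_Un:
  assumes "f \<in> zspan X l (B \<union> C)"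
  shows "\<exists>g\<in>zspan X l B. \<exists>h\<in>zspan X l C. \<forall>k\<in>X. f k = g k + h k"
  using assms
proof induction
  case zero
  show ?case by (intro bexI[OF _ zspan.zero]) simp
next
  case (base f)
  then show ?case
    by (metis Un_iff add.right_neutral add_0 zspan.base zspan.zero)
next
  case (add f1 f2)
  then obtain g1 h1 g2 h2 where
    "g1 \<in> zspan X l B" "h1 \<in> zspan X l C" "\<forall>k\<in>X. f1 k = g1 k + h1 k"
    "g2 \<in> zspan X l B" "h2 \<in> zspan X l C" "\<forall>k\<in>X. f2 k = g2 k + h2 k" by blast
  then show ?case
    by (intro bexI[of _ "\<lambda>k. g1 k + g2 k"] bexI[of _ "\<lambda>k. h1 k + h2 k"]) (auto intro: zspan.add)
next
  case (uminus f)
  then obtain g h where "g \<in> zspan X l B" "h \<in> zspan X l C" "\<forall>k\<in>X. f k = g k + h k" by blast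
  then show ?case
    by (intro bexI[of _ "\<lambda>k. - g k"] bexI[of _ "\<lambda>k. - h k"]) (auto intro: zspan.uminus)
next
  case (mult f)
  then obtain g h where "g \<in> zspan X l B" "h \<in> zspan X l C" "\<forall>k\<in>X. f k = g k + h k" by blast
  then show ?case
    by (intro bexI[of _ "\<lambda>k. l k * g k"] bexI[of _ "\<lambda>k. l k * h k"])
      (auto intro: zspan.mult simp: distrib_left)
next
  case (cong f g)
  then show ?case by metis
qed

text \<open>The relations hold pointwise on \<open>X\<close>, but \<open>j\<close> is a single
  constant. The first six concern \<open>l\<close>, \<open>x\<close>, \<open>y\<close>,
  \<open>z\<close> alone; the last four make each of \<open>t\<close>, \<open>u\<close>,
  \<open>v\<close>, \<open>w\<close> equal to \<open>j\<close> times an integral polynomial in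
  these.\<close>

locale trace_relations =
  fixes X :: "'k set" and l x y z t u v w :: "'k \<Rightarrow> complex" and j :: complex
  assumes j: "j\<^sup>2 = -1"
    and relations: "\<And>k. k \<in> X \<Longrightarrow> y k * z k = 2 * x k"
    "\<And>k. k \<in> X \<Longrightarrow> (x k)\<^sup>2 = l k + 6 - (y k)\<^sup>2"
    "\<And>k. k \<in> X \<Longrightarrow> (y k)^4 = (l k + 6) * (y k)\<^sup>2 - 2 * l k - 12"
    "\<And>k. k \<in> X \<Longrightarrow> x k * z k = (l k + 4) * y k - (y k)^3"
    "\<And>k. k \<in> X \<Longrightarrow> (z k)\<^sup>2 = 2 * (l k + 4 - (y k)\<^sup>2)"
    "\<And>k. k \<in> X \<Longrightarrow> x k * (y k)^3 = (l k + 6) * (x k * y k - z k)"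
    "\<And>k. k \<in> X \<Longrightarrow> t k = j * (l k + 4 - (y k)\<^sup>2)"
    "\<And>k. k \<in> X \<Longrightarrow> u k = j * x k"
    "\<And>k. k \<in> X \<Longrightarrow> v k = y k * t k - j * y k"
    "\<And>k. k \<in> X \<Longrightarrow> w k = j * z k"
begin

definition E_basis :: "('k \<Rightarrow> complex) set" where
  "E_basis = {\<lambda>_. 1, y, \<lambda>k. (y k)\<^sup>2, \<lambda>k. (y k)^3, x, z, \<lambda>k. x k * y k, \<lambda>k. x k * (y k)\<^sup>2}"

definition J_basis :: "('k \<Rightarrow> complex) set" where
  "J_basis = {t, u, v, w, \<lambda>k. t k * y k, \<lambda>k. u k * y k, \<lambda>k. t k * x k, \<lambda>k. u k * x k, \<lambda>k. v k * y k}"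

abbreviation "E \<equiv> zspan X l E_basis"
abbreviation "J \<equiv> zspan X l J_basis"
abbreviation "S \<equiv> zspan X l (E_basis \<union> J_basis)"

lemma E_basis_mem:
  "(\<lambda>_. 1) \<in> E" "y \<in> E" "(\<lambda>k. (y k)\<^sup>2) \<in> E" "(\<lambda>k. (y k)^3) \<in> E" "x \<in> E" "z \<in> E"
  "(\<lambda>k. x k * y k) \<in> E" "(\<lambda>k. x k * (y k)\<^sup>2) \<in> E"
  by (rule zspan.base, simp add: E_basis_def)+

lemma J_basis_mem:
  "t \<in> J" "u \<in> J" "v \<in> J" "w \<in> J" "(\<lambda>k. t k * y k) \<in> J" "(\<lambda>k. u k * y k) \<in> J"
  "(\<lambda>k. t k * x k) \<in> J" "(\<lambda>k. u k * x k) \<in> J" "(\<lambda>k. v k * y k) \<in> J"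
  by (rule zspan.base, simp add: J_basis_def)+

text \<open>These are the multiplication tables of \<open>x\<close>, \<open>y\<close>,
  \<open>z\<close> on \<open>E_basis\<close>. The right sides imitate the closure rules of
  \<open>zspan\<close>, hence the explicit factors 1; the trivial rows are present because the table
  also instantiates the unknown right side in \<open>E_mult\<close>.\<close>

lemma E_products:
  assumes "k \<in> X"
  shows "x k * 1 = x k"
    "x k * y k = x k * y k"
    "x k * (y k)\<^sup>2 = x k * (y k)\<^sup>2"
    "x k * (y k)^3 = (l k * (x k * y k) + 6 * (x k * y k)) - (l k * z k + 6 * z k)"
    "x k * x k = l k * 1 + 6 * 1 - (y k)\<^sup>2"
    "x k * z k = l k * y k + 4 * y k - (y k)^3"
    "x k * (x k * y k) = l k * y k + 6 * y k - (y k)^3"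
    "x k * (x k * (y k)\<^sup>2) = 2 * (l k * 1) + 12 * 1"
    "y k * 1 = y k"
    "y k * y k = (y k)\<^sup>2"
    "y k * (y k)\<^sup>2 = (y k)^3"
    "y k * (y k)^3 = l k * (y k)\<^sup>2 + 6 * (y k)\<^sup>2 - (2 * (l k * 1) + 12 * 1)"
    "y k * x k = x k * y k"
    "y k * z k = 2 * x k"
    "y k * (x k * y k) = x k * (y k)\<^sup>2"
    "y k * (x k * (y k)\<^sup>2) = (l k * (x k * y k) + 6 * (x k * y k)) - (l k * z k + 6 * z k)"
    "z k * 1 = z k"
    "z k * y k = 2 * x k"
    "z k * (y k)\<^sup>2 = 2 * (x k * y k)"
    "z k * (y k)^3 = 2 * (x k * (y k)\<^sup>2)"
    "z k * x k = l k * y k + 4 * y k - (y k)^3"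
    "z k * z k = 2 * (l k * 1) + 8 * 1 - 2 * (y k)\<^sup>2"
    "z k * (x k * y k) = 2 * (l k * 1) + 12 * 1 - 2 * (y k)\<^sup>2"
    "z k * (x k * (y k)\<^sup>2) = 2 * (l k * y k) + 12 * y k - 2 * (y k)^3"
  using relations(1-6)[OF assms] by - (Groebner_Basis.algebra
    | (simp (no_asm) add: power2_eq_square power3_eq_cube; fail))+

text \<open>Every row is linear in \<open>t\<close>, \<open>u\<close>, \<open>v\<close>,
  \<open>w\<close>. Substituting the last four relations therefore turns it into \<open>j\<close>
  times an identity that follows from the first six.\<close>

lemma J_products:
  assumes "k \<in> X"
  shows "x k * t k = t k * x k"
    "x k * u k = u k * x k"
    "x k * v k = l k * w k + 6 * w k - 3 * (u k * y k)"
    "x k * w k = t k * y k"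
    "x k * (t k * y k) = l k * w k + 6 * w k - 2 * (u k * y k)"
    "x k * (u k * y k) = 3 * (t k * y k) - 2 * v k"
    "x k * (t k * x k) = l k * t k + 6 * t k - 2 * (u k * x k)"
    "x k * (u k * x k) = t k * x k + 2 * u k"
    "x k * (v k * y k) = 3 * (t k * x k) - l k * u k"
    "y k * t k = t k * y k"
    "y k * u k = u k * y k"
    "y k * v k = v k * y k"
    "y k * w k = 2 * u k"
    "y k * (t k * y k) = 2 * (u k * x k)"
    "y k * (u k * y k) = l k * u k + 4 * u k - t k * x k"
    "y k * (t k * x k) = l k * w k + 6 * w k - 2 * (u k * y k)"
    "y k * (u k * x k) = 3 * (t k * y k) - 2 * v k"
    "y k * (v k * y k) = 3 * (t k * y k) - l k * (t k * y k) + l k * v k"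
    "z k * t k = l k * w k + 4 * w k - 2 * (u k * y k)"
    "z k * u k = t k * y k"
    "z k * v k = 2 * (t k * x k) - 2 * u k"
    "z k * w k = 2 * t k"
    "z k * (t k * y k) = 2 * (t k * x k)"
    "z k * (u k * y k) = 2 * (u k * x k)"
    "z k * (t k * x k) = l k * (t k * y k) - 2 * (t k * y k) + 4 * v k"
    "z k * (u k * x k) = l k * w k + 6 * w k - 2 * (u k * y k)"
    "z k * (v k * y k) = 2 * (l k * w k) + 12 * w k - 6 * (u k * y k)"
  using relations(1-6)[OF assms] unfolding relations(7-10)[OF assms] by - (Groebner_Basis.algebra
    | (simp (no_asm) add: power2_eq_square power3_eq_cube; fail))+

text \<open>Since \<open>-j\<close> is the inverse of \<open>j\<close>, multiplying by it strips the
  factor \<open>j\<close> from each element of \<open>J_basis\<close>.\<close>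

lemma j_products:
  assumes "k \<in> X"
  shows "- j * t k = l k * 1 + 4 * 1 - (y k)\<^sup>2"
    "- j * u k = x k"
    "- j * v k = l k * y k + 3 * y k - (y k)^3"
    "- j * w k = z k"
    "- j * (t k * y k) = l k * y k + 4 * y k - (y k)^3"
    "- j * (u k * y k) = x k * y k"
    "- j * (t k * x k) = l k * x k + 4 * x k - x k * (y k)\<^sup>2"
    "- j * (u k * x k) = l k * 1 + 6 * 1 - (y k)\<^sup>2"
    "- j * (v k * y k) = 2 * (l k * 1) + 12 * 1 - 3 * (y k)\<^sup>2"
  using relations(1-6)[OF assms] j unfolding relations(7-10)[OF assms] by - (Groebner_Basis.algebra
    | (simp (no_asm) add: power2_eq_square power3_eq_cube; fail))+

lemmas zspan_combine = zspan.add zspan_diff zspan_numeral zspan.mult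

lemma E_mult:
  assumes "f \<in> E"
  shows "(\<lambda>k. x k * f k) \<in> E" "(\<lambda>k. y k * f k) \<in> E" "(\<lambda>k. z k * f k) \<in> E"
  by (rule zspan_mult_left[OF assms], unfold E_basis_def, elim insertE emptyE;
      erule ssubst; rule zspan_cong, erule E_products, fold E_basis_def,
      intro zspan_combine E_basis_mem)+

lemma J_mult:
  assumes "f \<in> J"
  shows "(\<lambda>k. x k * f k) \<in> J" "(\<lambda>k. y k * f k) \<in> J" "(\<lambda>k. z k * f k) \<in> J"
  by (rule zspan_mult_left[OF assms], unfold J_basis_def, elim insertE emptyE;
      erule ssubst; rule zspan_cong, erule J_products, fold J_basis_def,
      intro zspan_combine J_basis_mem)+

lemma j_mult: "f \<in> J \<Longrightarrow> (\<lambda>k. - j * f k) \<in> E"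
  by (rule zspan_mult_left[of f X l J_basis], assumption, unfold J_basis_def, elim insertE emptyE;
      erule ssubst; rule zspan_cong, erule j_products,
      intro zspan_combine E_basis_mem)

text \<open>Each element of \<open>E_basis\<close> is a monomial in \<open>x\<close>,
  \<open>y\<close>, \<open>z\<close>, so closure under these three is enough. With \<open>B\<close>
  left general this shows both that \<open>E\<close> is a ring and that \<open>J\<close> is an
  \<open>E\<close>-module.\<close>

lemma E_basis_mult:
  assumes f: "f \<in> zspan X l B" and g: "g \<in> E"
    and closed: "\<And>h. h \<in> zspan X l B \<Longrightarrow> (\<lambda>k. x k * h k) \<in> zspan X l B"
      "\<And>h. h \<in> zspan X l B \<Longrightarrow> (\<lambda>k. y k * h k) \<in> zspan X l B"
      "\<And>h. h \<in> zspan X l B \<Longrightarrow> (\<lambda>k. z k * h k) \<in> zspan X l B"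
  shows "(\<lambda>k. f k * g k) \<in> zspan X l B"
proof (rule zspan_mult_left[OF g])
  fix b assume "b \<in> E_basis"
  moreover note y1 = closed(2)[OF f]
  moreover note y2 = closed(2)[OF y1]
  moreover note closed(2)[OF y2] closed(1,3)[OF f] closed(1)[OF y1] closed(1)[OF y2] f
  ultimately show "(\<lambda>k. f k * b k) \<in> zspan X l B"
    by (auto simp: E_basis_def power2_eq_square power3_eq_cube ac_simps)
qed

lemma S_mult:
  assumes "f \<in> S" "g \<in> S"
  shows "(\<lambda>k. f k * g k) \<in> S"
proof -
  have E_mono: "h \<in> E \<Longrightarrow> h \<in> S" and J_mono: "h \<in> J \<Longrightarrow> h \<in> S" for h
    by (rule zspan_mono[rotated], assumption, blast)+
  obtain e1 g1 where 1: "e1 \<in> E" "g1 \<in> J" "\<forall>k\<in>X. f k = e1 k + g1 k"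
    using zspan_Un[OF assms(1)] by blast
  obtain e2 g2 where 2: "e2 \<in> E" "g2 \<in> J" "\<forall>k\<in>X. g k = e2 k + g2 k"
    using zspan_Un[OF assms(2)] by blast
  note EE = E_basis_mult[OF _ _ E_mult] and JE = E_basis_mult[OF _ _ J_mult]
  note EE[OF 1(1) 2(1)] EE[OF j_mult[OF 1(2)] j_mult[OF 2(2)]] JE[OF 2(2) 1(1)] JE[OF 1(2) 2(1)]
  \<comment> \<open>As \<open>(-j)^2 = -1\<close>, the product \<open>g1 g2\<close> is minus a
    product of two elements of \<open>E\<close>; the mixed terms lie in \<open>J\<close>.\<close>
  then have "(\<lambda>k. e1 k * e2 k - (- j * g1 k) * (- j * g2 k) + (g2 k * e1 k + g1 k * e2 k)) \<in> S"
    by (intro zspan.add zspan_diff E_mono J_mono)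
  then show ?thesis
  proof (rule zspan.cong)
    fix k assume "k \<in> X"
    have "(- j * g1 k) * (- j * g2 k) = - (g1 k * g2 k)" using j by Groebner_Basis.algebra
    then show "f k * g k = e1 k * e2 k - (- j * g1 k) * (- j * g2 k) + (g2 k * e1 k + g1 k * e2 k)"
      using 1(3) 2(3) \<open>k \<in> X\<close> by (simp add: algebra_simps)
  qed
qed

end

section \<open>Regular functions and trace rings\<close>

lemma function_ring_simps [simp]:
  "carrier (function_ring X) = X \<rightarrow>\<^sub>E UNIV"
  "f \<otimes>\<^bsub>function_ring X\<^esub> g = (\<lambda>s\<in>X. f s * g s)"
  "\<one>\<^bsub>function_ring X\<^esub> = (\<lambda>s\<in>X. 1)"
  "\<zero>\<^bsub>function_ring X\<^esub> = (\<lambda>s\<in>X. 0)"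
  "f \<oplus>\<^bsub>function_ring X\<^esub> g = (\<lambda>s\<in>X. f s + g s)"
  by (simp_all add: function_ring_def)

lemma coordinate_ring_simps [simp]:
  "f \<otimes>\<^bsub>coordinate_ring G X\<^esub> g = (\<lambda>s\<in>X. f s * g s)"
  "\<one>\<^bsub>coordinate_ring G X\<^esub> = (\<lambda>s\<in>X. 1)"
  "\<zero>\<^bsub>coordinate_ring G X\<^esub> = (\<lambda>s\<in>X. 0)"
  "f \<oplus>\<^bsub>coordinate_ring G X\<^esub> g = (\<lambda>s\<in>X. f s + g s)"
  by (simp_all add: coordinate_ring_def)

lemma trace_ring_simps [simp]:
  "f \<otimes>\<^bsub>trace_ring G X\<^esub> g = (\<lambda>s\<in>X. f s * g s)"
  "\<one>\<^bsub>trace_ring G X\<^esub> = (\<lambda>s\<in>X. 1)"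
  "\<zero>\<^bsub>trace_ring G X\<^esub> = (\<lambda>s\<in>X. 0)"
  "f \<oplus>\<^bsub>trace_ring G X\<^esub> g = (\<lambda>s\<in>X. f s + g s)"
  by (simp_all add: trace_ring_def)

lemma ring_function_ring: "ring (function_ring X)"
  by (rule cring.axioms(1)[OF cring_function_ring])

lemma coordinate_ring_carrier: "carrier (coordinate_ring G X) =
    generate_ring (function_ring X) (range (\<lambda>c. \<lambda>\<kappa>\<in>X. c) \<union> eval_fun X ` carrier G)"
  by (simp add: coordinate_ring_def)

lemma trace_ring_carrier:
  "carrier (trace_ring G X) = generate_ring (coordinate_ring G X) (eval_fun X ` carrier G)"
  by (simp add: trace_ring_def)

lemma coordinate_ring_generators:
  "range (\<lambda>c. \<lambda>\<kappa>\<in>X. c) \<union> eval_fun X ` carrier G \<subseteq> carrier (function_ring X)"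
  by (auto simp: eval_fun_def)

lemma ring_coordinate_ring: "ring (coordinate_ring G X)"
  unfolding coordinate_ring_def
  by (rule ring.generate_ring_is_ring[OF ring_function_ring coordinate_ring_generators])

lemma coordinate_ring_extensional: "carrier (coordinate_ring G X) \<subseteq> X \<rightarrow>\<^sub>E UNIV"
  using ring.generate_ring_incl[OF ring_function_ring coordinate_ring_generators[of X G]]
  by (simp add: coordinate_ring_carrier)

lemma eval_fun_coordinate_ring: "\<gamma> \<in> carrier G \<Longrightarrow> eval_fun X \<gamma> \<in> carrier (coordinate_ring G X)"
  by (auto simp: coordinate_ring_carrier intro: generate_ring.incl)

lemma ring_trace_ring: "ring (trace_ring G X)"
  unfolding trace_ring_def
  by (rule ring.generate_ring_is_ring[OF ring_coordinate_ring]) (auto intro: eval_fun_coordinate_ring)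

lemma eval_fun_trace_ring: "\<gamma> \<in> carrier G \<Longrightarrow> eval_fun X \<gamma> \<in> carrier (trace_ring G X)"
  by (auto simp: trace_ring_carrier intro: generate_ring.incl)

lemma trace_ring_subset_coordinate_ring: "carrier (trace_ring G X) \<subseteq> carrier (coordinate_ring G X)"
  unfolding trace_ring_carrier
  by (rule ring.generate_ring_incl[OF ring_coordinate_ring]) (auto intro: eval_fun_coordinate_ring)

lemma trace_ring_extensional: "f \<in> carrier (trace_ring G X) \<Longrightarrow> restrict f X = f"
  using trace_ring_subset_coordinate_ring[of G X] coordinate_ring_extensional[of G X]
  by (intro extensional_restrict) (auto simp: PiE_def)

lemma a_inv_pointwise:
  fixes R :: "('s \<Rightarrow> complex, 'm) ring_scheme"
  assumes "ring R" "carrier R \<subseteq> X \<rightarrow>\<^sub>E UNIV" "f \<in> carrier R"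
    and "\<And>g. g \<oplus>\<^bsub>R\<^esub> f = (\<lambda>s\<in>X. g s + f s)" "\<zero>\<^bsub>R\<^esub> = (\<lambda>s\<in>X. 0)"
  shows "\<ominus>\<^bsub>R\<^esub> f = (\<lambda>s\<in>X. - f s)"
proof -
  interpret ring R by fact
  have "\<ominus>\<^bsub>R\<^esub> f \<in> X \<rightarrow>\<^sub>E UNIV" using assms(2,3) by blast
  moreover have "(\<ominus>\<^bsub>R\<^esub> f) s = - f s" if "s \<in> X" for s
    using fun_cong[OF l_neg[OF assms(3)], of s] that by (simp add: assms(4,5) eq_neg_iff_add_eq_0)
  ultimately show ?thesis
    by (auto simp: PiE_def extensional_def fun_eq_iff)
qed

lemma a_inv_coordinate_ring:
  "f \<in> carrier (coordinate_ring G X) \<Longrightarrow> \<ominus>\<^bsub>coordinate_ring G X\<^esub> f = (\<lambda>s\<in>X. - f s)"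
  by (rule a_inv_pointwise[OF ring_coordinate_ring coordinate_ring_extensional]) simp_all

lemma a_inv_trace_ring:
  "f \<in> carrier (trace_ring G X) \<Longrightarrow> \<ominus>\<^bsub>trace_ring G X\<^esub> f = (\<lambda>s\<in>X. - f s)"
  using trace_ring_subset_coordinate_ring[of G X] coordinate_ring_extensional[of G X]
  by (intro a_inv_pointwise[OF ring_trace_ring]) auto

text \<open>Each rule that builds the trace ring is matched by a closure property of
  \<open>S\<close>, and the restrictions to \<open>X\<close> are absorbed by
  \<open>cong\<close>.\<close>

lemma (in trace_subring) trace_ring_subset:
  assumes "\<And>w. tr w \<in> S" and "f \<in> carrier (trace_ring (presented_group E) X)"
  shows "f \<in> S"
  using assms(2) unfolding trace_ring_carrier
proof induction
  case one
  show ?case by (rule cong[OF trace_subring.one[OF trace_subring_axioms]]) simp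
next
  case (incl h)
  then obtain w where "h = eval_fun X (pres_class E w)"
    by (auto simp: carrier_presented_group)
  then show ?case by (intro cong[OF assms(1)[of w]]) (simp add: eval_fun_def tr_def)
next
  case (a_inv h)
  have "h \<in> carrier (coordinate_ring (presented_group E) X)"
    using a_inv(1) trace_ring_subset_coordinate_ring unfolding trace_ring_carrier by blast
  then show ?case
    by (intro cong[OF diff[OF diff[OF one one] a_inv(2)]]) (simp add: a_inv_coordinate_ring)
next
  case (eng_add h1 h2)
  show ?case by (rule cong[OF add[OF eng_add(3,4)]]) simp
next
  case (eng_mult h1 h2)
  show ?case by (rule cong[OF mult[OF eng_mult(3,4)]]) simp
qed

section \<open>Regular functions and cancellation on irreducible sets\<close>

definition regular :: "('a, 'm) monoid_scheme \<Rightarrow> (('a \<Rightarrow> complex) \<Rightarrow> complex) \<Rightarrow> bool" where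
  "regular G f \<longleftrightarrow> restrict f (char_variety G) \<in> carrier (coordinate_ring G (char_variety G))"

lemma regular_const: "regular G (\<lambda>_. a)"
  by (auto simp: regular_def coordinate_ring_carrier intro!: generate_ring.incl)

lemma regular_eval: "\<gamma> \<in> carrier G \<Longrightarrow> regular G (\<lambda>\<kappa>. \<kappa> \<gamma>)"
  using eval_fun_coordinate_ring[of \<gamma> G "char_variety G"] by (simp add: regular_def eval_fun_def)

lemma regular_add: "regular G f \<Longrightarrow> regular G g \<Longrightarrow> regular G (\<lambda>\<kappa>. f \<kappa> + g \<kappa>)"
  and regular_mult: "regular G f \<Longrightarrow> regular G g \<Longrightarrow> regular G (\<lambda>\<kappa>. f \<kappa> * g \<kappa>)"
  unfolding regular_def
  using generate_ring.eng_add[of "restrict f (char_variety G)" "function_ring (char_variety G)" _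
      "restrict g (char_variety G)"]
    generate_ring.eng_mult[of "restrict f (char_variety G)" "function_ring (char_variety G)" _
      "restrict g (char_variety G)"]
  by (simp_all add: coordinate_ring_carrier cong: restrict_cong)

lemma regular_diff: "regular G f \<Longrightarrow> regular G g \<Longrightarrow> regular G (\<lambda>\<kappa>. f \<kappa> - g \<kappa>)"
  using regular_add[OF _ regular_mult[OF regular_const[of G "-1"]], of f g] by simp

lemma regular_power: "regular G f \<Longrightarrow> regular G (\<lambda>\<kappa>. f \<kappa> ^ n)"
  by (induction n) (simp_all add: regular_const regular_mult)

text \<open>The zero sets of \<open>f\<close> and \<open>g\<close> within \<open>X\<close> are
  algebraic and cover \<open>X\<close>, so one of them is all of \<open>X\<close>.\<close>

lemma irreducible_subset_zero_product:
  assumes "irreducible_subset G X" "regular G f" "regular G g" "\<And>\<kappa>. \<kappa> \<in> X \<Longrightarrow> f \<kappa> * g \<kappa> = 0"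
  shows "(\<forall>\<kappa>\<in>X. f \<kappa> = 0) \<or> (\<forall>\<kappa>\<in>X. g \<kappa> = 0)"
proof -
  let ?V = "char_variety G"
  obtain F where F: "F \<subseteq> carrier (coordinate_ring G ?V)" "X = {\<kappa> \<in> ?V. \<forall>f\<in>F. f \<kappa> = 0}"
    using assms(1) by (auto simp: irreducible_subset_def algebraic_subset_def)
  have alg: "algebraic_subset G {\<kappa> \<in> X. h \<kappa> = 0}" if "regular G h" for h
    unfolding algebraic_subset_def
    by (rule exI[of _ "insert (restrict h ?V) F"]) (use that F in \<open>auto simp: regular_def\<close>)
  have "X = {\<kappa> \<in> X. f \<kappa> = 0} \<union> {\<kappa> \<in> X. g \<kappa> = 0}"
    using assms(4) by auto
  then have "X = {\<kappa> \<in> X. f \<kappa> = 0} \<or> X = {\<kappa> \<in> X. g \<kappa> = 0}"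
    using assms(1) alg[OF assms(2)] alg[OF assms(3)] unfolding irreducible_subset_def by blast
  then show ?thesis by blast
qed

section \<open>The trace ring of a hyperbolic curve\<close>

text \<open>This is elimination at a single point, dividing by \<open>y\<close>, \<open>x\<close>
  and \<open>y^2 - 4\<close>. Eliminating \<open>z\<close> from the first two relations gives
  \<open>A\<close>, which also shows that \<open>x\<close> is nonzero.\<close>

lemma generic_relations:
  fixes x y z t u v w l :: complex
  assumes R: "y * z = 2 * x" "x\<^sup>2 * y - x * z = 2 * y" "l = x\<^sup>2 + y\<^sup>2 + z\<^sup>2 - x * y * z - 2"
    "x * w = y * t" "x * v + y * u = x * y * t" "y * w = x\<^sup>2 * u - x * t"
    "u\<^sup>2 = x * t * u - t\<^sup>2 - y\<^sup>2 + l + 2"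
    and "y \<noteq> 0" "y\<^sup>2 \<noteq> 4"
  shows "x \<noteq> 0" "x\<^sup>2 = l + 6 - y\<^sup>2" "y^4 = (l + 6) * y\<^sup>2 - 2 * l - 12" "x * z = (l + 4) * y - y^3"
    "z\<^sup>2 = 2 * (l + 4 - y\<^sup>2)" "x * y^3 = (l + 6) * (x * y - z)"
    "y\<^sup>2 * t = 2 * x * u" "(t * (y\<^sup>2 - 2))\<^sup>2 = - 16"
proof -
  have A: "x\<^sup>2 * (y\<^sup>2 - 2) = 2 * y\<^sup>2" using R(1,2) by Groebner_Basis.algebra
  then show x: "x \<noteq> 0" using \<open>y \<noteq> 0\<close> by auto
  have "y\<^sup>2 * x\<^sup>2 = y\<^sup>2 * (l + 6 - y\<^sup>2)" using R(1,3) A by Groebner_Basis.algebra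
  then show B: "x\<^sup>2 = l + 6 - y\<^sup>2" using \<open>y \<noteq> 0\<close> by simp
  show C: "y^4 = (l + 6) * y\<^sup>2 - 2 * l - 12" using A B by Groebner_Basis.algebra
  show "x * z = (l + 4) * y - y^3" using R(2) B by Groebner_Basis.algebra
  have "y\<^sup>2 * z\<^sup>2 = y\<^sup>2 * (2 * (l + 4 - y\<^sup>2))" using R(1) B C by Groebner_Basis.algebra
  then show "z\<^sup>2 = 2 * (l + 4 - y\<^sup>2)" using \<open>y \<noteq> 0\<close> by simp
  have "y * (x * y^3) = y * ((l + 6) * (x * y - z))" using R(1) C by Groebner_Basis.algebra
  then show "x * y^3 = (l + 6) * (x * y - z)" using \<open>y \<noteq> 0\<close> by simp
  \<comment> \<open>Eliminating \<open>w\<close> gives \<open>(x^2 + y^2) t = x^3 u\<close>, and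
    \<open>A\<close> reads \<open>x^2 y^2 = 2 (x^2 + y^2)\<close>.\<close>
  have "x\<^sup>2 * (y\<^sup>2 * t) = x\<^sup>2 * (2 * x * u)" using R(4,6) A by Groebner_Basis.algebra
  then show D: "y\<^sup>2 * t = 2 * x * u" using x by simp
  have F: "t\<^sup>2 * (y^4 - 2 * x\<^sup>2 * y\<^sup>2 + 4 * x\<^sup>2) = 4 * x\<^sup>2 * (x\<^sup>2 - 4)"
    using R(7) B D by Groebner_Basis.algebra
  \<comment> \<open>In terms of \<open>s\<close>, \<open>A\<close> says
    \<open>x^2 s = 2 (s + 2)\<close>. Clearing \<open>x^2\<close> from \<open>F\<close> with it
    leaves \<open>(s + 2) (s - 2) ((t s)^2 + 16) = 0\<close>.\<close>
  define s where "s = y\<^sup>2 - 2"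
  have s: "y\<^sup>2 = s + 2" by (simp add: s_def)
  have "2 * y\<^sup>2 * ((s - 2) * ((t * s)\<^sup>2 + 16)) = 0"
    using F A s by Groebner_Basis.algebra
  moreover have "s - 2 \<noteq> 0" using \<open>y\<^sup>2 \<noteq> 4\<close> by (simp add: s)
  ultimately have "(t * s)\<^sup>2 + 16 = 0" using \<open>y \<noteq> 0\<close> by simp
  then show "(t * (y\<^sup>2 - 2))\<^sup>2 = - 16" by (simp only: s_def eq_neg_iff_add_eq_0)
qed

lemma generic_relations_j:
  fixes x y z t u v w l j :: complex
  assumes "x * w = y * t" "x * v + y * u = x * y * t"
    "x\<^sup>2 = l + 6 - y\<^sup>2" "y^4 = (l + 6) * y\<^sup>2 - 2 * l - 12" "x * z = (l + 4) * y - y^3"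
    "y\<^sup>2 * t = 2 * x * u" "t * (y\<^sup>2 - 2) = 4 * j" "x \<noteq> 0"
  shows "t = j * (l + 4 - y\<^sup>2)" "u = j * x" "v = y * t - j * y" "w = j * z"
proof -
  \<comment> \<open>The quartic relation is \<open>(y^2 - 2) (l + 4 - y^2) = 4\<close>, so
    multiplying the equation for \<open>j\<close> by \<open>l + 4 - y^2\<close> solves it for
    \<open>t\<close>.\<close>
  have "4 * t = 4 * (j * (l + 4 - y\<^sup>2))" using assms(4,7) by Groebner_Basis.algebra
  then show t: "t = j * (l + 4 - y\<^sup>2)" by simp
  have "x * (2 * u) = x * (2 * (j * x))" using assms(3,4,6) t by Groebner_Basis.algebra
  then show u: "u = j * x" using \<open>x \<noteq> 0\<close> by simp
  have "x * v = x * (y * t - j * y)" using assms(2) u by Groebner_Basis.algebra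
  then show "v = y * t - j * y" using \<open>x \<noteq> 0\<close> by simp
  have "x * w = x * (j * z)" using assms(1,5) t by Groebner_Basis.algebra
  then show "w = j * z" using \<open>x \<noteq> 0\<close> by simp
qed

lemma hyperbolic_curve_relations:
  assumes "hyperbolic_curve pi1N X"
  defines "tr \<equiv> \<lambda>w \<kappa>. \<kappa> (pres_class N_relations w)"
  shows "\<exists>j. trace_relations X (tr ([pa, pb] @ word_inv [pa] @ word_inv [pb])) (tr [pa]) (tr [pb])
    (tr [pa, pb]) (tr [pt]) (tr [pa, pt]) (tr [pb, pt]) (tr [pa, pb, pt]) j"
proof -
  define l x y z t u v w where "l = tr ([pa, pb] @ word_inv [pa] @ word_inv [pb])"
    and "x = tr [pa]" and "y = tr [pb]" and "z = tr [pa, pb]" and "t = tr [pt]"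
    and "u = tr [pa, pt]" and "v = tr [pb, pt]" and "w = tr [pa, pb, pt]"
  note defs = this
  have irr: "irreducible_subset pi1N X"
    using assms(1) by (simp add: hyperbolic_curve_def irreducible_component_def)
  then have V: "X \<subseteq> char_variety pi1N"
    by (auto simp: irreducible_subset_def algebraic_subset_def)
  obtain \<rho> where \<rho>: "discrete_faithful pi1N \<rho>" "char_of pi1N \<rho> \<in> X"
    using assms(1) by (auto simp: hyperbolic_curve_def)
  have y0: "y (char_of pi1N \<rho>) \<noteq> 0" "(y (char_of pi1N \<rho>))\<^sup>2 \<noteq> 4"
    using faithful_trace_beta[of \<rho>] \<rho>(1)
    by (simp_all add: discrete_faithful_def y_def tr_def \<beta>_def pres_gen_def)
  have reg: "regular pi1N (tr p)" for p
    unfolding tr_def by (rule regular_eval) (simp add: pi1N_def carrier_presented_group)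
  have character: "N_character \<kappa>" if "\<kappa> \<in> X" for \<kappa>
    using that V by unfold_locales (auto simp: pi1N_def)
  have c: "presented_character.c N_relations \<kappa> p = tr p \<kappa>" if "\<kappa> \<in> X" for \<kappa> p
    by (simp add: presented_character.c_def[OF N_character.axioms[OF character[OF that]]] tr_def)
  have base: "y \<kappa> * z \<kappa> = 2 * x \<kappa>" "(x \<kappa>)\<^sup>2 * y \<kappa> - x \<kappa> * z \<kappa> = 2 * y \<kappa>"
    "l \<kappa> = (x \<kappa>)\<^sup>2 + (y \<kappa>)\<^sup>2 + (z \<kappa>)\<^sup>2 - x \<kappa> * y \<kappa> * z \<kappa> - 2"
    "x \<kappa> * w \<kappa> = y \<kappa> * t \<kappa>" "x \<kappa> * v \<kappa> + y \<kappa> * u \<kappa> = x \<kappa> * y \<kappa> * t \<kappa>"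
    "y \<kappa> * w \<kappa> = (x \<kappa>)\<^sup>2 * u \<kappa> - x \<kappa> * t \<kappa>"
    "(u \<kappa>)\<^sup>2 = x \<kappa> * t \<kappa> * u \<kappa> - (t \<kappa>)\<^sup>2 - (y \<kappa>)\<^sup>2 + l \<kappa> + 2"
    if "\<kappa> \<in> X" for \<kappa>
    using N_character.trace_alpha[OF character] N_character.trace_beta[OF character]
      N_character.trace_commutator[OF character] N_character.trace_alpha_beta_tau[OF character]
      N_character.trace_beta_tau[OF character] N_character.trace_alpha_cubed_tau[OF character]
      N_character.trace_alpha_tau_square[OF character] that
    unfolding defs by (simp_all only: c)
  note generic = generic_relations[OF base]
  have regs: "regular pi1N l" "regular pi1N x" "regular pi1N y" "regular pi1N z"
    "regular pi1N t" "regular pi1N u" "regular pi1N v" "regular pi1N w"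
    unfolding defs by (rule reg)+
  note regI = regular_diff regular_add regular_mult regular_power regular_const regs
  \<comment> \<open>An identity of regular functions that holds wherever \<open>y (y^2 - 4)\<close>
    is nonzero holds on all of \<open>X\<close>: this factor does not vanish at the character of
    \<rho>, and \<open>X\<close> is irreducible.\<close>
  have zero: "f \<kappa> = g \<kappa>"
    if "\<kappa> \<in> X" "regular pi1N f" "regular pi1N g"
      "\<And>\<kappa>. \<kappa> \<in> X \<Longrightarrow> y \<kappa> \<noteq> 0 \<Longrightarrow> (y \<kappa>)\<^sup>2 \<noteq> 4 \<Longrightarrow> f \<kappa> = g \<kappa>" for f g \<kappa>
  proof -
    have "regular pi1N (\<lambda>\<kappa>. y \<kappa> * ((y \<kappa>)\<^sup>2 - 4))" "regular pi1N (\<lambda>\<kappa>. f \<kappa> - g \<kappa>)"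
      by (intro regI that)+
    moreover have "(y \<kappa> * ((y \<kappa>)\<^sup>2 - 4)) * (f \<kappa> - g \<kappa>) = 0" if "\<kappa> \<in> X" for \<kappa>
      using that(1) \<open>\<And>\<kappa>. \<kappa> \<in> X \<Longrightarrow> y \<kappa> \<noteq> 0 \<Longrightarrow> (y \<kappa>)\<^sup>2 \<noteq> 4 \<Longrightarrow> f \<kappa> = g \<kappa>\<close>[of \<kappa>] by auto
    ultimately have "(\<forall>\<kappa>\<in>X. y \<kappa> * ((y \<kappa>)\<^sup>2 - 4) = 0) \<or> (\<forall>\<kappa>\<in>X. f \<kappa> - g \<kappa> = 0)"
      by (rule irreducible_subset_zero_product[OF irr])
    then show ?thesis using \<rho>(2) y0 that(1) by auto
  qed
  let ?s = "\<lambda>\<kappa>. t \<kappa> * ((y \<kappa>)\<^sup>2 - 2)"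
  have "(?s \<kappa>)\<^sup>2 = - 16" if "\<kappa> \<in> X" for \<kappa>
    by (rule zero[OF that]) (intro regI, intro regI, rule generic)
  moreover have "(s - 4 * \<i>) * (s - (- 4 * \<i>)) = s\<^sup>2 + 16" for s :: complex
    by (simp add: algebra_simps power2_eq_square)
  ultimately have "(?s \<kappa> - 4 * \<i>) * (?s \<kappa> - (- 4 * \<i>)) = 0" if "\<kappa> \<in> X" for \<kappa>
    using that by simp
  \<comment> \<open>Irreducibility selects one square root of -16 for the whole curve, so
    \<open>j\<close> does not vary with the point.\<close>
  then have "(\<forall>\<kappa>\<in>X. ?s \<kappa> - 4 * \<i> = 0) \<or> (\<forall>\<kappa>\<in>X. ?s \<kappa> - (- 4 * \<i>) = 0)"
    by (intro irreducible_subset_zero_product[OF irr] regI)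
  then obtain j where j: "j\<^sup>2 = - 1" "\<And>\<kappa>. \<kappa> \<in> X \<Longrightarrow> ?s \<kappa> = 4 * j"
  proof
    assume "\<forall>\<kappa>\<in>X. ?s \<kappa> - 4 * \<i> = 0"
    then show thesis by (intro that[of \<i>]) auto
  next
    assume "\<forall>\<kappa>\<in>X. ?s \<kappa> - (- 4 * \<i>) = 0"
    then show thesis by (intro that[of "- \<i>"]) (auto simp: eq_neg_iff_add_eq_0)
  qed
  have genj: "t \<kappa> = j * (l \<kappa> + 4 - (y \<kappa>)\<^sup>2)" "u \<kappa> = j * x \<kappa>" "v \<kappa> = y \<kappa> * t \<kappa> - j * y \<kappa>"
      "w \<kappa> = j * z \<kappa>"
    if \<kappa>: "\<kappa> \<in> X" "y \<kappa> \<noteq> 0" "(y \<kappa>)\<^sup>2 \<noteq> 4" for \<kappa>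
    using generic_relations_j[OF base(4,5)[OF \<kappa>(1)] generic_relations(2,3,4,7)[OF base[OF \<kappa>(1)] \<kappa>(2,3)]
      j(2)[OF \<kappa>(1)] generic_relations(1)[OF base[OF \<kappa>(1)] \<kappa>(2,3)]]
    by blast+
  have "trace_relations X l x y z t u v w j"
  proof
    fix \<kappa> assume \<kappa>: "\<kappa> \<in> X"
    show "y \<kappa> * z \<kappa> = 2 * x \<kappa>" by (rule base(1)[OF \<kappa>])
    show "(x \<kappa>)\<^sup>2 = l \<kappa> + 6 - (y \<kappa>)\<^sup>2"
      by (rule zero[OF \<kappa>]) (intro regI, intro regI, rule generic)
    show "(y \<kappa>)^4 = (l \<kappa> + 6) * (y \<kappa>)\<^sup>2 - 2 * l \<kappa> - 12"
      by (rule zero[OF \<kappa>]) (intro regI, intro regI, rule generic)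
    show "x \<kappa> * z \<kappa> = (l \<kappa> + 4) * y \<kappa> - (y \<kappa>)^3"
      by (rule zero[OF \<kappa>]) (intro regI, intro regI, rule generic)
    show "(z \<kappa>)\<^sup>2 = 2 * (l \<kappa> + 4 - (y \<kappa>)\<^sup>2)"
      by (rule zero[OF \<kappa>]) (intro regI, intro regI, rule generic)
    show "x \<kappa> * (y \<kappa>)^3 = (l \<kappa> + 6) * (x \<kappa> * y \<kappa> - z \<kappa>)"
      by (rule zero[OF \<kappa>]) (intro regI, intro regI, rule generic)
    show "t \<kappa> = j * (l \<kappa> + 4 - (y \<kappa>)\<^sup>2)"
      by (rule zero[OF \<kappa>]) (intro regI, intro regI, rule genj)
    show "u \<kappa> = j * x \<kappa>"
      by (rule zero[OF \<kappa>]) (intro regI, intro regI, rule genj)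
    show "v \<kappa> = y \<kappa> * t \<kappa> - j * y \<kappa>"
      by (rule zero[OF \<kappa>]) (intro regI, intro regI, rule genj)
    show "w \<kappa> = j * z \<kappa>"
      by (rule zero[OF \<kappa>]) (intro regI, intro regI, rule genj)
  qed (rule j(1))
  then show ?thesis unfolding defs by blast
qed

section \<open>From spans of functions to generation of a module\<close>

lemma mult_module_simps:
  "carrier (mult_module R) = carrier R" "f \<oplus>\<^bsub>mult_module R\<^esub> g = f \<oplus>\<^bsub>R\<^esub> g"
  "\<zero>\<^bsub>mult_module R\<^esub> = \<zero>\<^bsub>R\<^esub>" "f \<odot>\<^bsub>mult_module R\<^esub> g = f \<otimes>\<^bsub>R\<^esub> g"
  by (simp_all add: mult_module_def ring.defs)

text \<open>A submodule containing the restricted generators is closed under every rule that builds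
  \<open>zspan\<close>; induction over the span then puts the whole trace ring into it.\<close>

lemma generates_module_trace_ring:
  assumes span: "\<And>f. f \<in> carrier (trace_ring G X) \<Longrightarrow> f \<in> zspan X l B"
    and l: "restrict l X \<in> carrier (trace_ring G X)"
    and B: "\<And>b. b \<in> B \<Longrightarrow> restrict b X \<in> carrier (trace_ring G X)"
  shows "generates_module (int_adjoin (trace_ring G X) (restrict l X)) (mult_module (trace_ring G X))
    ((\<lambda>b. restrict b X) ` B)"
  unfolding generates_module_def
proof (intro conjI allI impI)
  let ?T = "trace_ring G X" and ?l = "restrict l X"
  show "(\<lambda>b. restrict b X) ` B \<subseteq> carrier (mult_module ?T)"
    using B by (auto simp: mult_module_simps)
  fix H assume H: "submodule H (int_adjoin ?T ?l) (mult_module ?T) \<and> (\<lambda>b. restrict b X) ` B \<subseteq> H"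
  then have sub: "submodule H (int_adjoin ?T ?l) (mult_module ?T)" by blast
  note grp = submodule.axioms(1)[OF sub]
  have scalars: "carrier (int_adjoin ?T ?l) = generate_ring ?T {?l}"
    by (simp add: int_adjoin_def)
  interpret T: ring ?T by (rule ring_trace_ring)
  have H_add: "(\<lambda>s\<in>X. f s + g s) \<in> H" if "restrict f X \<in> H" "restrict g X \<in> H" for f g
  proof -
    have "restrict f X \<oplus>\<^bsub>?T\<^esub> restrict g X \<in> H"
      using subgroup.m_closed[OF grp that] by (simp only: mult_module_simps monoid.simps)
    also have "restrict f X \<oplus>\<^bsub>?T\<^esub> restrict g X = (\<lambda>s\<in>X. f s + g s)"
      by (auto simp: fun_eq_iff)
    finally show ?thesis .
  qed
  have H_smult: "(\<lambda>s\<in>X. a s * f s) \<in> H"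
    if "restrict a X \<in> generate_ring ?T {?l}" "restrict f X \<in> H" for a f
  proof -
    have "restrict a X \<otimes>\<^bsub>?T\<^esub> restrict f X \<in> H"
      using submodule.smult_closed[OF sub, of "restrict a X"] that
      by (simp only: mult_module_simps scalars)
    also have "restrict a X \<otimes>\<^bsub>?T\<^esub> restrict f X = (\<lambda>s\<in>X. a s * f s)"
      by (auto simp: fun_eq_iff)
    finally show ?thesis .
  qed
  \<comment> \<open>The sign rule of \<open>zspan\<close> is realised in \<open>H\<close> by the
    scalar -1.\<close>
  have minus_one: "restrict (\<lambda>_. - 1) X \<in> generate_ring ?T {?l}"
  proof -
    have "\<ominus>\<^bsub>?T\<^esub> \<one>\<^bsub>?T\<^esub> = restrict (\<lambda>_. - 1) X"
      unfolding a_inv_trace_ring[OF T.one_closed] by (auto simp: fun_eq_iff)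
    then show ?thesis using generate_ring.a_inv[OF generate_ring.one, of ?T "{?l}"] by simp
  qed
  have H_span: "restrict f X \<in> H" if "f \<in> zspan X l B" for f
    using that
  proof induction
    case zero
    have "\<zero>\<^bsub>mult_module ?T\<^esub> \<in> H" using subgroup.one_closed[OF grp] by simp
    then show ?case by (simp only: mult_module_simps trace_ring_simps)
  next
    case (base f)
    then show ?case using H by blast
  next
    case (add f g)
    show ?case by (rule H_add[OF add.IH])
  next
    case (uminus f)
    show ?case using H_smult[OF minus_one uminus.IH] by (simp only: mult_minus1)
  next
    case (mult f)
    show ?case by (rule H_smult[OF generate_ring.incl mult.IH]) simp
  next
    case (cong f g)
    have "restrict g X = restrict f X" using cong.hyps(2) by (auto simp: fun_eq_iff)
    then show ?case using cong.IH by simp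
  qed
  show "H = carrier (mult_module ?T)"
  proof
    show "H \<subseteq> carrier (mult_module ?T)" using subgroup.subset[OF grp] by simp
    show "carrier (mult_module ?T) \<subseteq> H"
    proof
      fix f assume "f \<in> carrier (mult_module ?T)"
      then have f: "f \<in> carrier ?T" by (simp add: mult_module_simps)
      show "f \<in> H" using H_span[OF span[OF f]] trace_ring_extensional[OF f] by simp
    qed
  qed
qed

theorem lemma7p16:
  fixes X :: "(letter word set \<Rightarrow> complex) set"
    and T :: "((letter word set \<Rightarrow> complex) \<Rightarrow> complex) ring" (structure)
  assumes "hyperbolic_curve pi1N X"
    and "T = trace_ring pi1N X"
    and "l = eval_fun X (\<alpha> \<otimes>\<^bsub>pi1N\<^esub> \<beta> \<otimes>\<^bsub>pi1N\<^esub> inv\<^bsub>pi1N\<^esub> \<alpha> \<otimes>\<^bsub>pi1N\<^esub> inv\<^bsub>pi1N\<^esub> \<beta>)"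
    and "t = eval_fun X \<tau>"
    and "u = eval_fun X (\<alpha> \<otimes>\<^bsub>pi1N\<^esub> \<tau>)"
    and "v = eval_fun X (\<beta> \<otimes>\<^bsub>pi1N\<^esub> \<tau>)"
    and "w = eval_fun X (\<alpha> \<otimes>\<^bsub>pi1N\<^esub> \<beta> \<otimes>\<^bsub>pi1N\<^esub> \<tau>)"
    and "x = eval_fun X \<alpha>"
    and "y = eval_fun X \<beta>"
    and "z = eval_fun X (\<alpha> \<otimes>\<^bsub>pi1N\<^esub> \<beta>)"
  shows "generates_module (int_adjoin T l) (mult_module T)
    {\<one>, y, y [^] (2::nat), y [^] (3::nat), t, u, v, w, x, z,
     t \<otimes> y, u \<otimes> y, x \<otimes> y, x \<otimes> y [^] (2::nat), t \<otimes> x, u \<otimes> x, v \<otimes> y}"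
proof -
  let ?tr = "\<lambda>w \<kappa>. \<kappa> (pres_class N_relations w)"
  let ?r = "\<lambda>f. restrict f X"
  obtain j where rel: "trace_relations X (?tr ([pa, pb] @ word_inv [pa] @ word_inv [pb])) (?tr [pa]) (?tr [pb])
    (?tr [pa, pb]) (?tr [pt]) (?tr [pa, pt]) (?tr [pb, pt]) (?tr [pa, pb, pt]) j"
    using hyperbolic_curve_relations[OF assms(1)] by blast
  interpret rel: trace_relations X "?tr ([pa, pb] @ word_inv [pa] @ word_inv [pb])" "?tr [pa]" "?tr [pb]"
    "?tr [pa, pb]" "?tr [pt]" "?tr [pa, pt]" "?tr [pb, pt]" "?tr [pa, pb, pt]" j
    by (rule rel)
  have V: "X \<subseteq> char_variety (presented_group N_relations)"
    using assms(1) by (auto simp: hyperbolic_curve_def irreducible_component_def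
        irreducible_subset_def algebraic_subset_def pi1N_def)
  interpret S: trace_subring N_relations X rel.S
  proof
    show "X \<subseteq> char_variety (presented_group N_relations)" by (rule V)
    show "(\<lambda>_. 1) \<in> rel.S" by (rule zspan.base) (simp add: rel.E_basis_def)
  qed (rule zspan_diff, assumption+, rule rel.S_mult, assumption+, rule zspan.cong, assumption, blast)
  \<comment> \<open>The seven traces required by \<open>tr_word\<close> are \<open>x\<close>,
    \<open>y\<close>, \<open>t\<close>, \<open>z\<close>, \<open>u\<close>, \<open>v\<close>,
    \<open>w\<close>, all of which belong to the two bases.\<close>
  have "S.tr p \<in> rel.S" for p
  proof (rule S.tr_word)
    show "g = Alpha \<or> g = Beta \<or> g = Tau" for g by (cases g) simp_all
  qed (unfold S.tr_def, (rule zspan.base, simp add: rel.E_basis_def rel.J_basis_def)+)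
  then have span: "f \<in> rel.S" if "f \<in> carrier T" for f
    using S.trace_ring_subset that by (simp add: assms(2) pi1N_def)
  have words: "l = ?r (?tr ([pa, pb] @ word_inv [pa] @ word_inv [pb]))" "t = ?r (?tr [pt])"
    "u = ?r (?tr [pa, pt])" "v = ?r (?tr [pb, pt])" "w = ?r (?tr [pa, pb, pt])" "x = ?r (?tr [pa])"
    "y = ?r (?tr [pb])" "z = ?r (?tr [pa, pb])"
    unfolding assms(3-)
    by (simp_all add: eval_fun_def \<alpha>_def \<beta>_def \<tau>_def pres_gen_def pi1N_def presented_group_mult
        inv_presented_group)
  interpret T: ring T unfolding assms(2) by (rule ring_trace_ring)
  have tr_T: "?r (?tr p) \<in> carrier T" for p
    using eval_fun_trace_ring[of "pres_class N_relations p" pi1N X]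
    by (simp add: assms(2) eval_fun_def pi1N_def carrier_presented_group)
  then have closed: "t \<in> carrier T" "u \<in> carrier T" "v \<in> carrier T" "w \<in> carrier T" "x \<in> carrier T"
    "y \<in> carrier T" "z \<in> carrier T"
    unfolding words by blast+
  have mult: "?r f \<otimes> ?r g = ?r (\<lambda>\<kappa>. f \<kappa> * g \<kappa>)" for f g
    unfolding assms(2) trace_ring_simps by (auto simp: fun_eq_iff)
  have one: "\<one> = ?r (\<lambda>_. 1)"
    unfolding assms(2) trace_ring_simps by simp
  have power: "?r f [^] n = ?r (\<lambda>\<kappa>. f \<kappa> ^ n)" for f and n :: nat
    by (induction n) (simp_all only: T.nat_pow_0 T.nat_pow_Suc one mult power_0 power_Suc2)
  let ?B = "{\<one>, y, y [^] (2::nat), y [^] (3::nat), t, u, v, w, x, z,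
     t \<otimes> y, u \<otimes> y, x \<otimes> y, x \<otimes> y [^] (2::nat), t \<otimes> x, u \<otimes> x, v \<otimes> y}"
  have B: "?B = ?r ` (rel.E_basis \<union> rel.J_basis)"
    unfolding rel.E_basis_def rel.J_basis_def words one power mult image_Un image_insert image_empty
    by blast
  have "?B \<subseteq> carrier T" using closed by simp
  then show ?thesis
    unfolding B unfolding words(1)
    using tr_T[of "[pa, pb] @ word_inv [pa] @ word_inv [pb]"] span
    unfolding assms(2) by (intro generates_module_trace_ring) auto
qed

end
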